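(* Let $p$ be a prime, $k$ a positive integer, and $q=p^k$ with $q\equiv 1\pmod 3$. Let $n$ be a positive integer with $\gcd\big(n,\frac{q-1}{3}\big)=1$. Then the number of elements $a\in\mathbb{F}_q$ for which $x^n\big(x^{\frac{q-1}{3}}+a\big)$ is a permutation polynomial of $\mathbb{F}_q$ equals $$\frac{2q-3(\epsilon_1+\epsilon_2)-10-2\big(\pi_p^{\,k}+\overline{\pi_p}^{\,k}\big)}{9},$$ where $\epsilon_1=-2$ if $q-3n\equiv 1\pmod 9$ and $\epsilon_1=1$ otherwise, and $\epsilon_2=-2$ if $n\equiv 0\pmod 3$ and $\epsilon_2=1$ otherwise.
   Context: A polynomial is a permutation polynomial of $\mathbb{F}_q$ if it induces a bijection of $\mathbb{F}_q$. Note $q\equiv1\pmod 3$ forces $p\neq3$. For a prime $p\neq 3$ define the integer $\kappa_p$ as follows: $\kappa_7=1$, $\kappa_{13}=-5$; if $p\equiv 1\pmod 3$ and $p\ge 19$, $\kappa_p$ is the unique integer with $|\kappa_p|\le 2\sqrt p$ and $\kappa_p\equiv-\binom{\frac{p-1}{2}}{\frac{p-1}{3}}\cdot 4^{-\frac{p-1}{6}}\pmod p$; if $p\equiv 2\pmod 3$ (including $p=2$), $\kappa_p=0$. Define the complex number $\pi_p=\frac{-\kappa_p}{2}+i\sqrt{p-\frac{\kappa_p^2}{4}}$, and $\overline{\pi_p}$ its complex conjugate. *)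

theory Defs
  imports Complex_Main "HOL-Number_Theory.Number_Theory"
begin

definition kappa :: "nat \<Rightarrow> int" where
  "kappa p =
     (if p = 7 then 1
      else if p = 13 then -5
      else if p mod 3 = 1 \<and> p \<ge> 19 then
        (THE k::int. \<bar>real_of_int k\<bar> \<le> 2 * sqrt (real p) \<and>
           [k * 4 ^ ((p - 1) div 6) = - int (((p - 1) div 2) choose ((p - 1) div 3))] (mod int p))
      else 0)"

definition pi_p :: "nat \<Rightarrow> complex" where
  "pi_p p = Complex (- real_of_int (kappa p) / 2)
                    (sqrt (real p - (real_of_int (kappa p))^2 / 4))"

end

theory Submission
  imports Defs "HOL-Computational_Algebra.Polynomial"
begin

text \<open>
  Write \<open>s = (q - 1) / 3\<close>. The binomial permutes the field iff \<open>z \<mapsto> z ^ n * (z + a) ^ s\<close> permutes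
  the cube roots of unity, and three cube roots of unity are distinct iff their product is \<open>1\<close> and
  they are not all equal. Both conditions on \<open>a\<close> are counted by cyclotomic numbers of order three,
  and these are all determined by \<open>A = 2 Re J\<close> for the cubic Jacobi sum \<open>J\<close>.

  Instead of the Hasse-Davenport relation, \<open>A\<close> is identified by arithmetic:
  \<open>|J|\<^sup>2 = q\<close> gives \<open>4 q = A\<^sup>2 + 27 B\<^sup>2\<close> with \<open>A \<equiv> 1 (mod 3)\<close>. If \<open>p \<equiv> 2 (mod 3)\<close>, then \<open>p\<close> is
  inert in the Eisenstein integers and a descent forces \<open>A\<close>. If \<open>p \<equiv> 1 (mod 3)\<close>, then power sums
  give \<open>A \<equiv> - binomial (2 s, s) (mod p)\<close>, which is nonzero by Lucas' theorem; such an \<open>A\<close> is unique,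
  and \<open>- (\<pi>\<^sup>k + cnj \<pi>\<^sup>k)\<close> has the same properties. The same congruence over the prime field,
  where \<open>4 ^ m * binomial (4 m, 2 m) \<equiv> binomial (3 m, 2 m)\<close> modulo \<open>p = 6 m + 1\<close>, identifies \<open>kappa p\<close>.
\<close>

section \<open>Finite subfields\<close>

lemma
  fixes c :: "'a::field"
  assumes "n > 0"
  shows finite_power_eq: "finite {x. x ^ n = c}"
    and card_power_eq_le: "card {x. x ^ n = c} \<le> n"
proof -
  define P where "P = monom 1 n + [:- c:]"
  have degree: "degree P = n"
    using assms unfolding P_def by (subst degree_add_eq_left) (simp_all add: degree_monom_eq)
  hence "P \<noteq> 0" using assms by auto
  moreover have "{x. poly P x = 0} = {x. x ^ n = c}"
    by (simp add: P_def poly_monom)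
  ultimately show "finite {x. x ^ n = c}" "card {x. x ^ n = c} \<le> n"
    using poly_roots_finite[of P] card_poly_roots_bound[of P] degree by auto
qed

lemma eq_of_coprime_powers_eq:
  fixes x y :: "'a::field"
  assumes "x ^ m = y ^ m" "x ^ n = y ^ n" "coprime m n" "m > 0" "y \<noteq> 0"
  shows "x = y"
proof -
  obtain i j where bezout: "m * i = n * j + 1"
    using bezout_nat[of m n] assms by auto
  define t where "t = x / y"
  have t: "t ^ m = 1" "t ^ n = 1" using assms by (simp_all add: t_def power_divide)
  have "1 = t ^ (m * i)" using t by (simp add: power_mult)
  also have "\<dots> = t" unfolding bezout power_add power_mult t by simp
  finally show ?thesis using assms by (simp add: t_def)
qed

lemma card_eq_sum_card_fibres:
  assumes "finite A" "finite B" "f ` A \<subseteq> B"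
  shows "card A = (\<Sum>b\<in>B. card {a \<in> A. f a = b})"
  using sum.group[OF assms, of "\<lambda>_. 1::nat"] by simp

lemma card_fibre_eq:
  assumes "finite A" "finite B" "f ` A \<subseteq> B"
    and fibre_le: "\<And>b. b \<in> B \<Longrightarrow> card {a \<in> A. f a = b} \<le> m"
    and "card A = n * m" "card B \<le> n" "b \<in> B"
  shows "card {a \<in> A. f a = b} = m"
proof (rule ccontr)
  assume "card {a \<in> A. f a = b} \<noteq> m"
  with fibre_le \<open>b \<in> B\<close> have "card {a \<in> A. f a = b} < m" by (simp add: nat_less_le)
  hence "(\<Sum>b\<in>B. card {a \<in> A. f a = b}) < (\<Sum>b\<in>B. m)"
    using assms by (intro sum_strict_mono_ex1) auto
  also have "\<dots> \<le> n * m" using assms by simp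
  finally show False using assms card_eq_sum_card_fibres[of A B f] by simp
qed

text \<open>Fields are modelled as subsets of an ambient type, so that the prime field of a finite field
  can be treated alongside the whole field.\<close>

locale finite_subfield =
  fixes K :: "'a::field set"
  assumes finite_K [simp]: "finite K"
    and one_mem [simp, intro]: "1 \<in> K"
    and diff_mem [simp, intro]: "\<lbrakk>x \<in> K; y \<in> K\<rbrakk> \<Longrightarrow> x - y \<in> K"
    and mult_mem [simp, intro]: "\<lbrakk>x \<in> K; y \<in> K\<rbrakk> \<Longrightarrow> x * y \<in> K"
begin

lemma zero_mem [simp, intro]: "0 \<in> K"
  using diff_mem[OF one_mem one_mem] by simp

lemma uminus_mem [simp, intro]: "x \<in> K \<Longrightarrow> - x \<in> K"
  using diff_mem[OF zero_mem] by force

lemma add_mem [simp, intro]: "\<lbrakk>x \<in> K; y \<in> K\<rbrakk> \<Longrightarrow> x + y \<in> K"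
  using diff_mem[OF _ uminus_mem, of x y] by simp

lemma power_mem [simp, intro]: "x \<in> K \<Longrightarrow> x ^ n \<in> K"
  by (induction n) auto

lemma mult_image_units:
  assumes "x \<in> K" "x \<noteq> 0"
  shows "(*) x ` (K - {0}) = K - {0}"
  using assms by (intro endo_inj_surj) (auto intro: inj_onI)

lemma inverse_mem [simp, intro]:
  assumes "x \<in> K"
  shows "inverse x \<in> K"
proof (cases "x = 0")
  case False
  have "1 \<in> (*) x ` (K - {0})"
    using mult_image_units[OF assms False] by simp
  then obtain y where "y \<in> K" "x * y = 1" by (metis DiffD1 imageE)
  thus ?thesis using inverse_unique by metis
qed simp

lemma divide_mem [simp, intro]: "\<lbrakk>x \<in> K; y \<in> K\<rbrakk> \<Longrightarrow> x / y \<in> K"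
  by (simp add: divide_inverse)

lemma card_ge_2: "card K \<ge> 2"
  using card_mono[of K "{0, 1}"] by simp

lemma card_factor_pos:
  assumes "card K - 1 = d * s"
  shows "d > 0" "s > 0"
proof -
  have "d * s \<noteq> 0" using assms card_ge_2 by linarith
  thus "d > 0" "s > 0" by simp_all
qed

lemma power_card_minus_1:
  assumes "x \<in> K" "x \<noteq> 0"
  shows "x ^ (card K - 1) = 1"
proof -
  have "\<Prod>(K - {0}) = \<Prod>((*) x ` (K - {0}))"
    by (simp only: mult_image_units[OF assms])
  also have "\<dots> = (\<Prod>y\<in>K - {0}. x * y)"
    using assms by (subst prod.reindex) (auto intro: inj_onI)
  also have "\<dots> = x ^ (card K - 1) * \<Prod>(K - {0})"
    by (simp add: prod.distrib)
  finally show ?thesis by simp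
qed

definition roots_of_unity :: "nat \<Rightarrow> 'a set" where
  "roots_of_unity d = {x \<in> K. x ^ d = 1}"

lemma finite_roots_of_unity [simp]: "finite (roots_of_unity d)"
  by (simp add: roots_of_unity_def)

lemma card_roots_of_unity_le:
  assumes "d > 0"
  shows "card (roots_of_unity d) \<le> d"
proof -
  have "card (roots_of_unity d) \<le> card {x::'a. x ^ d = 1}"
    by (intro card_mono finite_power_eq assms) (auto simp: roots_of_unity_def)
  also have "\<dots> \<le> d" by (rule card_power_eq_le[OF assms])
  finally show ?thesis .
qed

lemma roots_of_unity_mult:
  "\<lbrakk>x \<in> roots_of_unity d; y \<in> roots_of_unity d\<rbrakk> \<Longrightarrow> x * y \<in> roots_of_unity d"
  by (simp add: roots_of_unity_def power_mult_distrib)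

lemma roots_of_unity_power:
  assumes "x \<in> roots_of_unity d"
  shows "x ^ n \<in> roots_of_unity d"
proof -
  have "(x ^ n) ^ d = (x ^ d) ^ n" by (simp add: mult.commute flip: power_mult)
  thus ?thesis using assms by (simp add: roots_of_unity_def)
qed

lemma power_mem_roots_of_unity:
  assumes "card K - 1 = d * s" "x \<in> K" "x \<noteq> 0"
  shows "x ^ s \<in> roots_of_unity d"
  using power_card_minus_1[OF assms(2,3)] assms
  by (simp add: roots_of_unity_def mult.commute flip: power_mult)

lemma card_power_fibre:
  assumes card: "card K - 1 = d * s" and "c \<in> roots_of_unity d"
  shows "card {x \<in> K - {0}. x ^ s = c} = s"
proof (rule card_fibre_eq)
  note pos = card_factor_pos[OF card]
  show "card (roots_of_unity d) \<le> d" by (rule card_roots_of_unity_le[OF pos(1)])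
  show "card {x \<in> K - {0}. x ^ s = b} \<le> s" for b
  proof -
    have "card {x \<in> K - {0}. x ^ s = b} \<le> card {x. x ^ s = b}"
      by (intro card_mono finite_power_eq pos) auto
    also have "\<dots> \<le> s" by (rule card_power_eq_le[OF pos(2)])
    finally show ?thesis .
  qed
  show "(\<lambda>x. x ^ s) ` (K - {0}) \<subseteq> roots_of_unity d"
    using power_mem_roots_of_unity[OF card] by blast
qed (use assms in simp_all)

lemma card_roots_of_unity:
  assumes "card K - 1 = d * s"
  shows "card (roots_of_unity d) = d"
proof -
  have "(\<lambda>x. x ^ s) ` (K - {0}) \<subseteq> roots_of_unity d"
    using power_mem_roots_of_unity[OF assms] by blast
  hence "card (K - {0}) = (\<Sum>c\<in>roots_of_unity d. card {x \<in> K - {0}. x ^ s = c})"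
    by (intro card_eq_sum_card_fibres) simp_all
  also have "\<dots> = card (roots_of_unity d) * s"
    using card_power_fibre[OF assms] by simp
  also have "card (K - {0}) = d * s" using assms by simp
  finally show ?thesis using card_factor_pos[OF assms] by simp
qed

lemma ex_power_eq:
  assumes "card K - 1 = d * s" "c \<in> roots_of_unity d"
  obtains x where "x \<in> K" "x \<noteq> 0" "x ^ s = c"
proof -
  have "{x \<in> K - {0}. x ^ s = c} \<noteq> {}"
    using card_power_fibre[OF assms] card_factor_pos[OF assms(1)]
    by (metis card.empty less_numeral_extra(3))
  thus ?thesis using that by blast
qed

lemma of_nat_card_eq_0: "of_nat (card K) = (0::'a)"
proof -
  have "(\<Sum>x\<in>K. x + 1) = (\<Sum>x\<in>K. x)"
    by (rule sum.reindex_bij_witness[of _ "\<lambda>x. x - 1" "\<lambda>x. x + 1"]) auto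
  thus ?thesis by (simp add: sum.distrib)
qed

lemma sum_mult_reindex:
  assumes "y \<in> K" "y \<noteq> 0"
  shows "(\<Sum>x\<in>K. g (y * x)) = (\<Sum>x\<in>K. g x)"
  by (rule sum.reindex_bij_witness[of _ "\<lambda>x. x / y" "\<lambda>x. y * x"]) (use assms in auto)

lemma sum_power_eq_0:
  assumes "j < card K - 1"
  shows "(\<Sum>x\<in>K. x ^ j) = 0"
proof (cases "j = 0")
  case True
  thus ?thesis by (simp add: of_nat_card_eq_0)
next
  case False
  have "\<not> K - {0} \<subseteq> roots_of_unity j"
    using card_mono[of "roots_of_unity j" "K - {0}"] card_roots_of_unity_le[of j] assms False
    by auto
  then obtain y where y: "y \<in> K" "y \<noteq> 0" "y ^ j \<noteq> 1" by (auto simp: roots_of_unity_def)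
  have "(\<Sum>x\<in>K. x ^ j) = (\<Sum>x\<in>K. (y * x) ^ j)"
    using sum_mult_reindex[of y "\<lambda>x. x ^ j"] y by simp
  also have "\<dots> = y ^ j * (\<Sum>x\<in>K. x ^ j)"
    by (simp add: power_mult_distrib sum_distrib_left)
  finally show ?thesis using y by simp
qed

lemma sum_power:
  assumes "j < 2 * (card K - 1)"
  shows "(\<Sum>x\<in>K. x ^ j) = (if j = card K - 1 then - 1 else 0)"
proof -
  consider "j < card K - 1" | "j = card K - 1" | i where "j = card K - 1 + i" "i > 0"
    by (metis less_imp_add_positive linorder_neqE_nat)
  thus ?thesis
  proof cases
    case 1
    thus ?thesis by (simp add: sum_power_eq_0)
  next
    case 2
    have "(\<Sum>x\<in>K. x ^ j) = (\<Sum>x\<in>K - {0}. 1)"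
      by (rule sum.mono_neutral_cong_right)
        (use 2 card_ge_2 power_card_minus_1 in \<open>auto simp: power_0_left\<close>)
    also have "\<dots> = - 1" using card_ge_2 by (simp add: of_nat_diff of_nat_card_eq_0)
    finally show ?thesis using 2 by simp
  next
    case 3
    have "x ^ j = x ^ i" if "x \<in> K" for x
      using power_card_minus_1[of x] that 3 by (cases "x = 0") (auto simp: power_add)
    thus ?thesis using assms 3 by (simp add: sum_power_eq_0)
  qed
qed

lemma sum_power_mult_one_minus_power:
  assumes "a \<le> card K - 1" "a + b < 2 * (card K - 1)"
  shows "(\<Sum>x\<in>K. x ^ a * (1 - x) ^ b) =
    - ((- 1) ^ (card K - 1 - a) * of_nat (b choose (card K - 1 - a)))"
proof -
  let ?e = "card K - 1 - a"
  have "x ^ a * (1 - x) ^ b = (\<Sum>i\<le>b. of_nat (b choose i) * (- 1) ^ i * x ^ (a + i))" for x :: 'a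
    using binomial_ring[of "- x" 1 b]
    by (simp add: sum_distrib_left power_add power_minus[of x] mult_ac)
  hence "(\<Sum>x\<in>K. x ^ a * (1 - x) ^ b) =
      (\<Sum>i\<le>b. of_nat (b choose i) * (- 1) ^ i * (\<Sum>x\<in>K. x ^ (a + i)))"
    by (simp add: sum_distrib_left sum.swap[of _ K])
  also have "\<dots> = (\<Sum>i\<le>b. if i = ?e then - ((- 1) ^ ?e * of_nat (b choose ?e)) else 0)"
    by (rule sum.cong) (use assms in \<open>auto simp: sum_power\<close>)
  finally show ?thesis by (simp add: sum.delta binomial_eq_0)
qed

context
  fixes d s n :: nat and h :: "'a \<Rightarrow> 'a"
  assumes card_eq: "card K - 1 = d * s" and n_pos: "n > 0"
    and h_mem: "\<And>z. z \<in> roots_of_unity d \<Longrightarrow> h z \<in> K"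
begin

lemma power_mult_power: "(x ^ n * h (x ^ s)) ^ s = (x ^ s) ^ n * h (x ^ s) ^ s"
  by (simp add: power_mult_distrib mult.commute flip: power_mult)

lemma power_mult_mem:
  assumes "x \<in> K"
  shows "x ^ n * h (x ^ s) \<in> K"
proof (cases "x = 0")
  case True
  thus ?thesis using n_pos by (simp add: power_0_left)
next
  case False
  thus ?thesis using assms h_mem power_mem_roots_of_unity[OF card_eq] by simp
qed

lemma bij_betw_roots_of_unity_if_bij_betw:
  assumes "bij_betw (\<lambda>x. x ^ n * h (x ^ s)) K K" (is "bij_betw ?f K K")
  shows "bij_betw (\<lambda>z. z ^ n * h z ^ s) (roots_of_unity d) (roots_of_unity d)"
    (is "bij_betw ?u ?R ?R")
proof -
  have f_neq_0: "?f x \<noteq> 0" if "x \<in> K" "x \<noteq> 0" for x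
    using inj_onD[OF bij_betw_imp_inj_on[OF assms], of x 0] that n_pos by auto
  have maps: "?u ` ?R \<subseteq> ?R"
  proof (rule image_subsetI)
    fix z assume "z \<in> ?R"
    then obtain x where x: "x \<in> K" "x \<noteq> 0" "x ^ s = z" using ex_power_eq[OF card_eq] by blast
    have "?f x ^ s \<in> ?R"
      by (intro power_mem_roots_of_unity[OF card_eq] power_mult_mem f_neq_0 x)
    thus "?u z \<in> ?R" unfolding power_mult_power by (simp only: x)
  qed
  have "?R \<subseteq> ?u ` ?R"
  proof
    fix c assume "c \<in> ?R"
    then obtain y where y: "y \<in> K" "y \<noteq> 0" "y ^ s = c" using ex_power_eq[OF card_eq] by blast
    then obtain x where x: "x \<in> K" "y = ?f x"
      using bij_betw_imp_surj_on[OF assms] by blast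
    have "x \<noteq> 0" using x y n_pos by auto
    hence "x ^ s \<in> ?R" using x power_mem_roots_of_unity[OF card_eq] by blast
    moreover have "c = ?u (x ^ s)" using power_mult_power[of x] x y by simp
    ultimately show "c \<in> ?u ` ?R" by blast
  qed
  with maps have image: "?u ` ?R = ?R" by blast
  hence "inj_on ?u ?R" by (intro eq_card_imp_inj_on) simp_all
  with image show ?thesis by (simp add: bij_betw_def)
qed

lemma bij_betw_if_bij_betw_roots_of_unity:
  assumes "coprime n s"
    and bij: "bij_betw (\<lambda>z. z ^ n * h z ^ s) (roots_of_unity d) (roots_of_unity d)"
      (is "bij_betw ?u ?R ?R")
  shows "bij_betw (\<lambda>x. x ^ n * h (x ^ s)) K K" (is "bij_betw ?f K K")
proof -
  have h_neq_0: "h z \<noteq> 0" if "z \<in> ?R" for z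
  proof
    assume "h z = 0"
    hence "0 \<in> ?R" using bij_betw_apply[OF bij that] card_factor_pos[OF card_eq]
      by (simp add: power_0_left)
    thus False using card_factor_pos[OF card_eq] by (simp add: roots_of_unity_def power_0_left)
  qed
  have f_eq_0_iff: "?f x = 0 \<longleftrightarrow> x = 0" if "x \<in> K" for x
    using h_neq_0 power_mem_roots_of_unity[OF card_eq that] n_pos by (cases "x = 0") auto
  have "inj_on ?f K"
  proof (rule inj_onI)
    fix x y assume xy: "x \<in> K" "y \<in> K" "?f x = ?f y"
    show "x = y"
    proof (cases "x = 0 \<or> y = 0")
      case True
      thus ?thesis using xy f_eq_0_iff by metis
    next
      case False
      hence mem: "x ^ s \<in> ?R" "y ^ s \<in> ?R" using xy power_mem_roots_of_unity[OF card_eq] by auto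
      have "?u (x ^ s) = ?u (y ^ s)" using xy(3) power_mult_power by metis
      hence eq: "x ^ s = y ^ s" using bij mem by (metis bij_betw_imp_inj_on inj_onD)
      hence "x ^ n = y ^ n" using xy(3) h_neq_0[OF mem(1)] by simp
      thus ?thesis using eq_of_coprime_powers_eq[of x n y s] eq assms n_pos False by simp
    qed
  qed
  moreover have "?f ` K \<subseteq> K" using power_mult_mem by blast
  ultimately show ?thesis by (simp add: bij_betw_def endo_inj_surj)
qed

end

theorem bij_betw_power_mult_iff:
  assumes "card K - 1 = d * s" "n > 0" "coprime n s"
    and "\<And>z. z \<in> roots_of_unity d \<Longrightarrow> h z \<in> K"
  shows "bij_betw (\<lambda>x. x ^ n * h (x ^ s)) K K \<longleftrightarrow>
    bij_betw (\<lambda>z. z ^ n * h z ^ s) (roots_of_unity d) (roots_of_unity d)"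
  using bij_betw_roots_of_unity_if_bij_betw[OF assms(1,2,4)]
    bij_betw_if_bij_betw_roots_of_unity[OF assms(1,2,4,3)] by (rule iffI)

section \<open>Characters and Jacobi sums\<close>

definition character :: "('a \<Rightarrow> complex) \<Rightarrow> bool" where
  "character \<chi> \<longleftrightarrow> \<chi> 0 = 0 \<and> \<chi> 1 = 1 \<and> (\<forall>x\<in>K. \<forall>y\<in>K. \<chi> (x * y) = \<chi> x * \<chi> y)"

definition nontrivial_character :: "('a \<Rightarrow> complex) \<Rightarrow> bool" where
  "nontrivial_character \<chi> \<longleftrightarrow> character \<chi> \<and> (\<exists>y\<in>K - {0}. \<chi> y \<noteq> 1)"

lemma character_mult: "\<lbrakk>character \<chi>; x \<in> K; y \<in> K\<rbrakk> \<Longrightarrow> \<chi> (x * y) = \<chi> x * \<chi> y"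
  by (simp add: character_def)

lemma character_power:
  assumes "character \<chi>" "x \<in> K"
  shows "\<chi> (x ^ n) = \<chi> x ^ n"
  using assms by (induction n) (simp_all add: character_def)

lemma norm_character:
  assumes "character \<chi>" "x \<in> K" "x \<noteq> 0"
  shows "cmod (\<chi> x) = 1"
proof -
  have "\<chi> x ^ (card K - 1) = \<chi> (x ^ (card K - 1))"
    by (simp only: character_power[OF assms(1,2)])
  also have "\<dots> = 1"
    using assms(1) by (simp only: power_card_minus_1[OF assms(2,3)] character_def)
  finally have "\<chi> x ^ (card K - 1) = 1" .
  hence "cmod (\<chi> x) ^ (card K - 1) = 1" by (metis norm_one norm_power)
  thus ?thesis using card_ge_2 power_eq_1_iff[of "cmod (\<chi> x)" "card K - 1"] by simp
qed

lemma character_mult_cnj: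
  assumes "character \<chi>" "x \<in> K"
  shows "\<chi> x * cnj (\<chi> x) = (if x = 0 then 0 else 1)"
  using assms norm_character[OF assms] by (simp add: character_def flip: complex_norm_square)

lemma character_divide:
  assumes "character \<chi>" "x \<in> K" "y \<in> K"
  shows "\<chi> (x / y) = \<chi> x * cnj (\<chi> y)"
proof (cases "y = 0")
  case True
  thus ?thesis using assms by (simp add: character_def)
next
  case False
  have "\<chi> (x / y) * \<chi> y = \<chi> x"
    using character_mult[of \<chi> "x / y" y] assms False by simp
  hence "\<chi> (x / y) * (\<chi> y * cnj (\<chi> y)) = \<chi> x * cnj (\<chi> y)" by (metis mult.assoc)
  thus ?thesis using assms False by (simp add: character_mult_cnj)
qed

lemma sum_nontrivial_character:
  assumes "nontrivial_character \<chi>"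
  shows "(\<Sum>x\<in>K. \<chi> x) = 0"
proof -
  obtain y where y: "y \<in> K" "y \<noteq> 0" "\<chi> y \<noteq> 1" and "character \<chi>"
    using assms by (auto simp: nontrivial_character_def)
  have "(\<Sum>x\<in>K. \<chi> x) = (\<Sum>x\<in>K. \<chi> (y * x))"
    by (rule sum_mult_reindex[symmetric]) fact+
  also have "\<dots> = \<chi> y * (\<Sum>x\<in>K. \<chi> x)"
    using y \<open>character \<chi>\<close> by (simp add: character_mult sum_distrib_left)
  finally show ?thesis using y by simp
qed

lemma sum_character_shift_cnj:
  assumes "nontrivial_character \<chi>" "x \<in> K" "y \<in> K"
  shows "(\<Sum>t\<in>K. \<chi> (t - x) * cnj (\<chi> (t - y))) = (if x = y then of_nat (card K) else 0) - 1"
proof (cases "x = y")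
  case True
  have "(\<Sum>t\<in>K. \<chi> (t - x) * cnj (\<chi> (t - x))) = (\<Sum>t\<in>K - {x}. 1)"
    by (rule sum.mono_neutral_cong_right)
      (use assms in \<open>auto simp: nontrivial_character_def character_mult_cnj\<close>)
  thus ?thesis using True assms card_ge_2 by (simp add: of_nat_diff)
next
  case False
  have \<chi>: "character \<chi>" using assms by (simp add: nontrivial_character_def)
  have "(\<Sum>t\<in>K. \<chi> (t - x) * cnj (\<chi> (t - y))) = (\<Sum>t\<in>K - {y}. \<chi> ((t - x) / (t - y)))"
    by (rule sum.mono_neutral_cong_right)
      (use assms \<chi> in \<open>auto simp: character_divide character_def\<close>)
  also have "\<dots> = (\<Sum>r\<in>K - {1}. \<chi> r)"
  proof (rule sum.reindex_bij_witness[of _ "\<lambda>r. y + (y - x) / (r - 1)" "\<lambda>t. (t - x) / (t - y)"])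
    fix t assume t: "t \<in> K - {y}"
    hence "(t - x) / (t - y) - 1 = (y - x) / (t - y)" by (simp add: field_simps)
    thus "y + (y - x) / ((t - x) / (t - y) - 1) = t" using False t by simp
    show "(t - x) / (t - y) \<in> K - {1}" using t assms False by simp
  next
    fix r assume r: "r \<in> K - {1}"
    hence "y + (y - x) / (r - 1) - x = (y - x) * r / (r - 1)" by (simp add: field_simps)
    thus "(y + (y - x) / (r - 1) - x) / (y + (y - x) / (r - 1) - y) = r" using r False by simp
    show "y + (y - x) / (r - 1) \<in> K - {y}" using r assms False by simp
  qed simp
  also have "\<dots> = (\<Sum>r\<in>K. \<chi> r) - \<chi> 1" by (simp add: sum_diff1)
  also have "\<dots> = - 1" using assms \<chi> by (simp add: sum_nontrivial_character character_def)
  finally show ?thesis using False by simp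
qed

definition jacobi_sum :: "('a \<Rightarrow> complex) \<Rightarrow> ('a \<Rightarrow> complex) \<Rightarrow> complex" where
  "jacobi_sum \<chi> \<psi> = (\<Sum>x\<in>K. \<chi> x * \<psi> (1 - x))"

lemma character_convolution:
  assumes "character \<chi>" "character \<psi>" "nontrivial_character (\<lambda>x. \<chi> x * \<psi> x)" "t \<in> K"
  shows "(\<Sum>x\<in>K. \<chi> x * \<psi> (t - x)) = \<chi> t * \<psi> t * jacobi_sum \<chi> \<psi>"
proof (cases "t = 0")
  case True
  have "(\<Sum>x\<in>K. \<chi> x * \<psi> (0 - x)) = (\<Sum>x\<in>K. \<psi> (- 1) * (\<chi> x * \<psi> x))"
  proof (rule sum.cong)
    fix x assume "x \<in> K"
    thus "\<chi> x * \<psi> (0 - x) = \<psi> (- 1) * (\<chi> x * \<psi> x)"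
      using character_mult[of \<psi> "- 1" x] assms by simp
  qed simp
  hence "(\<Sum>x\<in>K. \<chi> x * \<psi> (0 - x)) = \<psi> (- 1) * (\<Sum>x\<in>K. \<chi> x * \<psi> x)"
    by (simp only: sum_distrib_left)
  thus ?thesis using True assms sum_nontrivial_character by (simp add: character_def)
next
  case False
  have "\<psi> (t - t * x) = \<psi> t * \<psi> (1 - x)" if "x \<in> K" for x
    using character_mult[of \<psi> t "1 - x"] that assms by (simp add: algebra_simps)
  hence "(\<Sum>x\<in>K. \<chi> (t * x) * \<psi> (t - t * x)) = \<chi> t * \<psi> t * jacobi_sum \<chi> \<psi>"
    using assms by (simp add: jacobi_sum_def sum_distrib_left character_mult mult_ac)
  thus ?thesis
    using sum_mult_reindex[OF assms(4) False, of "\<lambda>x. \<chi> x * \<psi> (t - x)"] by simp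
qed

lemma sum_character_mult_cnj:
  assumes "character \<chi>"
  shows "(\<Sum>x\<in>K. \<chi> x * cnj (\<chi> x)) = of_nat (card K) - 1"
proof -
  have "(\<Sum>x\<in>K. \<chi> x * cnj (\<chi> x)) = (\<Sum>x\<in>K - {0}. 1)"
    by (rule sum.mono_neutral_cong_right) (use assms in \<open>auto simp: character_mult_cnj\<close>)
  thus ?thesis using card_ge_2 by (simp add: of_nat_diff)
qed

lemma sum_convolution_mult_cnj:
  assumes \<chi>: "nontrivial_character \<chi>" and \<psi>: "nontrivial_character \<psi>"
  defines "T \<equiv> \<lambda>t. \<Sum>x\<in>K. \<chi> x * \<psi> (t - x)"
  shows "(\<Sum>t\<in>K. T t * cnj (T t)) = (of_nat (card K) - 1) * of_nat (card K)"
proof -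
  have "character \<chi>" using \<chi> by (simp add: nontrivial_character_def)
  have "(\<Sum>t\<in>K. T t * cnj (T t)) =
      (\<Sum>t\<in>K. \<Sum>x\<in>K. \<Sum>y\<in>K. \<chi> x * cnj (\<chi> y) * (\<psi> (t - x) * cnj (\<psi> (t - y))))"
    by (simp add: T_def sum_product mult_ac)
  also have "\<dots> = (\<Sum>x\<in>K. \<Sum>y\<in>K. \<Sum>t\<in>K. \<chi> x * cnj (\<chi> y) * (\<psi> (t - x) * cnj (\<psi> (t - y))))"
    by (subst sum.swap) (rule sum.cong[OF refl], rule sum.swap)
  also have "\<dots> = (\<Sum>x\<in>K. \<Sum>y\<in>K. \<chi> x * cnj (\<chi> y) * ((if x = y then of_nat (card K) else 0) - 1))"
    by (simp add: sum_character_shift_cnj[OF \<psi>] flip: sum_distrib_left)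
  also have "\<dots> = of_nat (card K) * (\<Sum>x\<in>K. \<chi> x * cnj (\<chi> x)) - (\<Sum>x\<in>K. \<chi> x) * cnj (\<Sum>x\<in>K. \<chi> x)"
    by (simp add: right_diff_distrib sum_subtractf sum_product sum_distrib_left mult_ac
        if_distrib[of "\<lambda>a. _ * a"] cong: if_cong) (rule sum.swap)
  finally show ?thesis
    by (simp add: sum_character_mult_cnj[OF \<open>character \<chi>\<close>] sum_nontrivial_character[OF \<chi>])
qed

theorem jacobi_sum_mult_cnj:
  assumes \<chi>: "nontrivial_character \<chi>" and \<psi>: "nontrivial_character \<psi>"
    and \<chi>\<psi>: "nontrivial_character (\<lambda>x. \<chi> x * \<psi> x)"
  shows "jacobi_sum \<chi> \<psi> * cnj (jacobi_sum \<chi> \<psi>) = of_nat (card K)"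
proof -
  let ?J = "jacobi_sum \<chi> \<psi>"
  have chars: "character \<chi>" "character \<psi>" "character (\<lambda>x. \<chi> x * \<psi> x)"
    using assms by (simp_all add: nontrivial_character_def)
  define T where "T t = (\<Sum>x\<in>K. \<chi> x * \<psi> (t - x))" for t
  have T_eq: "T t = \<chi> t * \<psi> t * ?J" if "t \<in> K" for t
    unfolding T_def by (rule character_convolution[OF chars(1,2) \<chi>\<psi> that])
  have "(of_nat (card K) - 1) * (?J * cnj ?J) =
      (\<Sum>t\<in>K. (\<chi> t * \<psi> t) * cnj (\<chi> t * \<psi> t)) * (?J * cnj ?J)"
    by (simp only: sum_character_mult_cnj[OF chars(3)])
  also have "\<dots> = (\<Sum>t\<in>K. T t * cnj (T t))"
    unfolding sum_distrib_right by (rule sum.cong) (simp_all add: T_eq mult_ac)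
  also have "\<dots> = (of_nat (card K) - 1) * of_nat (card K)"
    unfolding T_def by (rule sum_convolution_mult_cnj[OF \<chi> \<psi>])
  finally show ?thesis using card_ge_2 by simp
qed

end

section \<open>Cyclotomic numbers of order three\<close>

locale cubic_subfield = finite_subfield K for K :: "'a::field set" +
  fixes w :: 'a and s :: nat
  assumes card_K: "card K = 3 * s + 1"
    and w_mem [simp, intro]: "w \<in> K"
    and w_cubed: "w ^ 3 = 1"
    and w_neq_1: "w \<noteq> 1"
begin

lemma card_minus_1: "card K - 1 = 3 * s" "card K - 1 = s * 3"
  using card_K by simp_all

lemma s_pos: "s > 0"
  by (rule card_factor_pos[OF card_minus_1(1)])

lemma w_square_eq: "w ^ 2 = - w - 1"
proof -
  have "(w - 1) * (w ^ 2 + w + 1) = w ^ 3 - 1"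
    by (simp add: algebra_simps power2_eq_square power3_eq_cube)
  hence "w ^ 2 + (w + 1) = 0" using w_neq_1 w_cubed by (simp add: add.assoc)
  thus ?thesis by (simp add: add_eq_0_iff2)
qed

lemma w_distinct [simp]:
  "w \<noteq> 0" "w \<noteq> 1" "1 \<noteq> w" "w ^ 2 \<noteq> 1" "1 \<noteq> w ^ 2" "w ^ 2 \<noteq> w" "w \<noteq> w ^ 2"
  using w_cubed w_neq_1 by (auto simp: power2_eq_square power3_eq_cube)

lemma w_power_simps [simp]:
  "w * w = w ^ 2" "w * w ^ 2 = 1" "w ^ 2 * w = 1" "w ^ 2 * w ^ 2 = w"
  "1 / w = w ^ 2" "1 / w ^ 2 = w" "w / w ^ 2 = w ^ 2" "w ^ 2 / w = w"
  "w ^ 4 = w"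
proof -
  show w_mult_w_square: "w * w = w ^ 2" "w * w ^ 2 = 1" "w ^ 2 * w = 1"
    using w_cubed by (simp_all add: power2_eq_square power3_eq_cube mult.assoc)
  moreover show w_square_mult_w_square: "w ^ 2 * w ^ 2 = w"
    by (metis w_mult_w_square(1,2) mult.assoc mult.right_neutral)
  ultimately show "1 / w = w ^ 2" "1 / w ^ 2 = w" "w / w ^ 2 = w ^ 2" "w ^ 2 / w = w" "w ^ 4 = w"
    by (simp_all add: divide_eq_eq)
qed

abbreviation mu3 :: "'a set" where "mu3 \<equiv> roots_of_unity 3"

lemma mu3_eq: "mu3 = {1, w, w ^ 2}"
proof (rule sym, rule card_subset_eq)
  have "1 \<in> mu3" "w \<in> mu3" by (simp_all add: roots_of_unity_def w_cubed)
  thus "{1, w, w ^ 2} \<subseteq> mu3" by (simp add: roots_of_unity_power)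
  show "card {1, w, w ^ 2} = card mu3"
    using card_roots_of_unity[OF card_minus_1(1)] by simp
qed simp

lemma sum_mu3: "(\<Sum>c\<in>mu3. f c) = f 1 + f w + f (w ^ 2)"
  unfolding mu3_eq by (simp add: add.assoc)

lemma w_power_mem_mu3: "w ^ m \<in> mu3"
  by (rule roots_of_unity_power) (simp add: mu3_eq)

lemma w_power_eq_1_iff: "w ^ m = 1 \<longleftrightarrow> 3 dvd m"
proof -
  have "w ^ m = w ^ (3 * (m div 3) + m mod 3)" by simp
  also have "\<dots> = w ^ (m mod 3)" unfolding power_add power_mult w_cubed by simp
  finally have "w ^ m = w ^ (m mod 3)" .
  moreover have "m mod 3 = 0 \<or> m mod 3 = 1 \<or> m mod 3 = 2" by linarith
  ultimately show ?thesis by (auto simp: dvd_eq_mod_eq_0)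
qed

lemma power_s_mem_mu3: "\<lbrakk>x \<in> K; x \<noteq> 0\<rbrakk> \<Longrightarrow> x ^ s \<in> mu3"
  by (rule power_mem_roots_of_unity[OF card_minus_1(1)])

lemma uminus_power_s: "(- x) ^ s = (x::'a) ^ s"
proof -
  have "((- 1) ^ 3) ^ s = (- 1 :: 'a) ^ (3 * s)" by (rule power_mult[symmetric])
  also have "\<dots> = 1"
    using power_card_minus_1[of "- 1"] card_minus_1 by simp
  finally show ?thesis by (simp add: power_minus[of x])
qed

definition cyc_set :: "'a \<Rightarrow> 'a \<Rightarrow> 'a set" where
  "cyc_set c d = {r \<in> K - {0, 1}. r ^ s = c \<and> (1 - r) ^ s = d}"

definition cyc_num :: "'a \<Rightarrow> 'a \<Rightarrow> nat" where
  "cyc_num c d = card (cyc_set c d)"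

lemma finite_cyc_set [simp]: "finite (cyc_set c d)"
  by (simp add: cyc_set_def)

lemma cyc_num_swap: "cyc_num c d = cyc_num d c"
  unfolding cyc_num_def
  by (intro bij_betw_same_card[of "\<lambda>r. 1 - r"] bij_betw_byWitness[where f' = "\<lambda>r. 1 - r"])
    (auto simp: cyc_set_def)

lemma inverse_mem_cyc_set:
  assumes "r \<in> cyc_set c d"
  shows "inverse r \<in> cyc_set (1 / c) (d / c)"
proof -
  have r: "r \<in> K" "r \<noteq> 0" "r \<noteq> 1" "r ^ s = c" "(1 - r) ^ s = d"
    using assms by (auto simp: cyc_set_def)
  have "1 - inverse r = - ((1 - r) / r)" using r by (simp add: field_simps)
  hence "(1 - inverse r) ^ s = d / c" using r by (simp only: uminus_power_s power_divide)
  thus ?thesis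
    using r by (auto simp: cyc_set_def power_inverse inverse_eq_divide power_divide)
qed

lemma cyc_num_inverse:
  assumes "c \<noteq> 0"
  shows "cyc_num (1 / c) (d / c) = cyc_num c d"
proof -
  have "inverse r \<in> cyc_set c d" if "r \<in> cyc_set (1 / c) (d / c)" for r
    using inverse_mem_cyc_set[OF that] assms by simp
  hence "bij_betw inverse (cyc_set c d) (cyc_set (1 / c) (d / c))"
    by (intro bij_betw_byWitness[where f' = inverse]) (auto intro: inverse_mem_cyc_set)
  thus ?thesis by (simp add: cyc_num_def bij_betw_same_card)
qed

lemma cyc_num_row:
  assumes "c \<in> mu3"
  shows "(\<Sum>d\<in>mu3. cyc_num c d) = (if c = 1 then s - 1 else s)"
proof -
  let ?R = "{x \<in> K - {0, 1}. x ^ s = c}"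
  have "(\<lambda>x. (1 - x) ^ s) ` ?R \<subseteq> mu3" by (auto intro!: power_s_mem_mu3)
  hence "card ?R = (\<Sum>d\<in>mu3. card {x \<in> ?R. (1 - x) ^ s = d})"
    by (intro card_eq_sum_card_fibres) simp_all
  also have "\<dots> = (\<Sum>d\<in>mu3. cyc_num c d)"
    by (intro sum.cong refl) (auto simp: cyc_num_def cyc_set_def intro!: arg_cong[where f = card])
  finally have "(\<Sum>d\<in>mu3. cyc_num c d) = card ?R" ..
  also have "?R = {x \<in> K - {0}. x ^ s = c} - {1}" by auto
  also have "card \<dots> = (if 1 \<in> {x \<in> K - {0}. x ^ s = c}
      then card {x \<in> K - {0}. x ^ s = c} - 1 else card {x \<in> K - {0}. x ^ s = c})"
    by (rule card_Diff_singleton_if)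
  also have "card {x \<in> K - {0}. x ^ s = c} = s"
    by (rule card_power_fibre[OF card_minus_1(1) assms])
  finally show ?thesis by auto
qed

lemma cyc_num_eq_1_w:
  "cyc_num w 1 = cyc_num 1 w" "cyc_num (w ^ 2) (w ^ 2) = cyc_num 1 w"
  using cyc_num_swap[of w 1] cyc_num_inverse[of w 1] by simp_all

lemma cyc_num_eq_1_w_square:
  "cyc_num (w ^ 2) 1 = cyc_num 1 (w ^ 2)" "cyc_num w w = cyc_num 1 (w ^ 2)"
  using cyc_num_swap[of "w ^ 2" 1] cyc_num_inverse[of "w ^ 2" 1] by simp_all

lemma cyc_num_w_w_square:
  "cyc_num w (w ^ 2) = cyc_num 1 1 + 1" "cyc_num (w ^ 2) w = cyc_num 1 1 + 1"
proof -
  have "cyc_num 1 1 + cyc_num 1 w + cyc_num 1 (w ^ 2) = s - 1"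
    using cyc_num_row[of 1] by (simp add: sum_mu3 mu3_eq)
  moreover have "cyc_num w 1 + cyc_num w w + cyc_num w (w ^ 2) = s"
    using cyc_num_row[of w] by (simp add: sum_mu3 mu3_eq)
  ultimately show "cyc_num w (w ^ 2) = cyc_num 1 1 + 1"
    using s_pos by (simp add: cyc_num_eq_1_w cyc_num_eq_1_w_square)
  thus "cyc_num (w ^ 2) w = cyc_num 1 1 + 1" using cyc_num_swap by metis
qed

section \<open>The cubic Jacobi sum\<close>

definition jacobi_count :: "'a \<Rightarrow> nat" where
  "jacobi_count c = card {r \<in> K - {0, 1}. (r * (1 - r)) ^ s = c}"

lemma mult_one_minus_power_s_mem_mu3:
  "\<lbrakk>r \<in> K; r \<noteq> 0; r \<noteq> 1\<rbrakk> \<Longrightarrow> (r * (1 - r)) ^ s \<in> mu3"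
  by (rule power_s_mem_mu3) auto

lemma jacobi_count_eq_sum_cyc_num:
  "jacobi_count c = (\<Sum>d\<in>mu3. cyc_num d (c / d))"
proof -
  let ?R = "{r \<in> K - {0, 1}. (r * (1 - r)) ^ s = c}"
  have "(\<lambda>r. r ^ s) ` ?R \<subseteq> mu3" by (auto intro!: power_s_mem_mu3)
  hence "jacobi_count c = (\<Sum>d\<in>mu3. card {r \<in> ?R. r ^ s = d})"
    unfolding jacobi_count_def by (intro card_eq_sum_card_fibres) simp_all
  also have "{r \<in> ?R. r ^ s = d} = cyc_set d (c / d)" if "d \<in> mu3" for d
    using that by (auto simp: cyc_set_def mu3_eq power_mult_distrib eq_divide_eq mult.commute)
  hence "(\<Sum>d\<in>mu3. card {r \<in> ?R. r ^ s = d}) = (\<Sum>d\<in>mu3. cyc_num d (c / d))"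
    by (simp add: cyc_num_def)
  finally show ?thesis .
qed

lemma jacobi_count_1: "jacobi_count 1 = 3 * cyc_num 1 1 + 2"
  and jacobi_count_w: "jacobi_count w = 3 * cyc_num 1 w"
  and jacobi_count_w_square: "jacobi_count (w ^ 2) = 3 * cyc_num 1 (w ^ 2)"
  by (simp_all add: jacobi_count_eq_sum_cyc_num sum_mu3
      cyc_num_w_w_square cyc_num_eq_1_w cyc_num_eq_1_w_square)

lemma sum_mult_one_minus_power_s:
  fixes e :: "'a \<Rightarrow> 'b::comm_semiring_1"
  assumes "e 0 = 0"
  shows "(\<Sum>x\<in>K. e ((x * (1 - x)) ^ s)) = (\<Sum>c\<in>mu3. of_nat (jacobi_count c) * e c)"
proof -
  let ?f = "\<lambda>x. (x * (1 - x)) ^ s"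
  have "(\<Sum>x\<in>K. e (?f x)) = (\<Sum>x\<in>K - {0, 1}. e (?f x))"
    using s_pos assms by (intro sum.mono_neutral_right) (auto simp: power_0_left)
  also have "\<dots> = (\<Sum>c\<in>mu3. \<Sum>x | x \<in> K - {0, 1} \<and> ?f x = c. e (?f x))"
    using mult_one_minus_power_s_mem_mu3 by (intro sum.group[symmetric]) auto
  also have "\<dots> = (\<Sum>c\<in>mu3. of_nat (jacobi_count c) * e c)"
    by (intro sum.cong refl) (simp add: jacobi_count_def)
  finally show ?thesis .
qed

lemma sum_jacobi_count: "(\<Sum>c\<in>mu3. jacobi_count c) = card K - 2"
proof -
  have "card (K - {0, 1}) = (\<Sum>c\<in>mu3. jacobi_count c)"
    unfolding jacobi_count_def using mult_one_minus_power_s_mem_mu3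
    by (intro card_eq_sum_card_fibres) auto
  thus ?thesis by (simp add: card_Diff_subset)
qed

text \<open>\<open>J + cnj J\<close> for the cubic Jacobi sum \<open>J\<close>, that is, minus the trace of Frobenius of the
  Fermat cubic.\<close>

definition jacobi_trace :: int where
  "jacobi_trace = 2 * int (jacobi_count 1) - int (jacobi_count w) - int (jacobi_count (w ^ 2))"

lemma jacobi_trace_eq_cyc_num: "jacobi_trace = 9 * int (cyc_num 1 1) + 8 - int (card K)"
proof -
  have "jacobi_count 1 + jacobi_count w + jacobi_count (w ^ 2) = card K - 2"
    using sum_jacobi_count by (simp add: sum_mu3)
  thus ?thesis using card_ge_2 by (simp add: jacobi_trace_def jacobi_count_1)
qed

lemma jacobi_trace_mod_3: "jacobi_trace mod 3 = 1"
  unfolding jacobi_trace_eq_cyc_num card_K by presburger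

lemma of_int_jacobi_trace: "of_int jacobi_trace = - (of_nat ((2 * s) choose s) :: 'a)"
proof -
  let ?S = "\<lambda>a. \<Sum>x\<in>K. x ^ a * (1 - x) ^ a"
  have trace: "(a + b * w + c * w ^ 2) + (a + b * w ^ 2 + c * w) = 2 * a - b - c" for a b c
    by (simp add: w_square_eq algebra_simps)
  have "?S s = 0"
    using sum_power_mult_one_minus_power[of s s] s_pos card_minus_1
    by (simp add: binomial_eq_0 del: One_nat_def)
  moreover have "?S s = of_nat (jacobi_count 1) + of_nat (jacobi_count w) * w
      + of_nat (jacobi_count (w ^ 2)) * w ^ 2"
    using sum_mult_one_minus_power_s[of "\<lambda>c. c"] by (simp add: sum_mu3 power_mult_distrib)
  moreover have "?S (2 * s) = - of_nat ((2 * s) choose s)"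
    using sum_power_mult_one_minus_power[of "2 * s" "2 * s"] s_pos card_minus_1 uminus_power_s[of 1]
    by (simp del: One_nat_def)
  moreover have "?S (2 * s) = of_nat (jacobi_count 1) + of_nat (jacobi_count w) * w ^ 2
      + of_nat (jacobi_count (w ^ 2)) * w"
    using sum_mult_one_minus_power_s[of "\<lambda>c. c ^ 2"]
    by (simp add: sum_mu3 power_mult_distrib mult.commute[of 2] power_mult power2_eq_square[of "w ^ 2"])
  ultimately have "- of_nat ((2 * s) choose s) =
      (of_nat (jacobi_count 1) + of_nat (jacobi_count w) * w + of_nat (jacobi_count (w ^ 2)) * w ^ 2) +
      (of_nat (jacobi_count 1) + of_nat (jacobi_count w) * w ^ 2 + of_nat (jacobi_count (w ^ 2)) * w)"
    by simp
  also have "\<dots> = of_int jacobi_trace"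
    by (simp add: trace jacobi_trace_def)
  finally show ?thesis ..
qed

lemma jacobi_trace_cong: "[jacobi_trace = - int ((2 * s) choose s)] (mod CHAR('a))"
proof -
  have "(of_int (jacobi_trace + int ((2 * s) choose s)) :: 'a) = 0"
    by (simp add: of_int_jacobi_trace)
  hence "int CHAR('a) dvd jacobi_trace - (- int ((2 * s) choose s))"
    unfolding of_int_eq_0_iff_char_dvd by simp
  thus ?thesis by (simp only: cong_iff_dvd_diff)
qed

end

definition zeta3 :: complex where "zeta3 = Complex (- 1 / 2) (sqrt 3 / 2)"

lemma zeta3_simps [simp]:
  "zeta3 * zeta3 = cnj zeta3" "zeta3 * cnj zeta3 = 1" "cnj zeta3 * zeta3 = 1"
  "cnj zeta3 * cnj zeta3 = zeta3" "zeta3 \<noteq> 1" "cnj zeta3 \<noteq> 1"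
  by (simp_all add: zeta3_def complex_eq_iff)

context cubic_subfield
begin

definition mu3_embedding :: "'a \<Rightarrow> complex" where
  "mu3_embedding c =
    (if c = 1 then 1 else if c = w then zeta3 else if c = w ^ 2 then cnj zeta3 else 0)"

definition cubic_character :: "'a \<Rightarrow> complex" where
  "cubic_character x = mu3_embedding (x ^ s)"

lemma mu3_embedding_simps [simp]:
  "mu3_embedding 0 = 0" "mu3_embedding 1 = 1" "mu3_embedding w = zeta3"
  "mu3_embedding (w ^ 2) = cnj zeta3"
  by (simp_all add: mu3_embedding_def)

lemma mu3_embedding_mult:
  "\<lbrakk>c \<in> mu3; d \<in> mu3\<rbrakk> \<Longrightarrow> mu3_embedding (c * d) = mu3_embedding c * mu3_embedding d"
  by (auto simp: mu3_eq)

lemma character_cubic_character: "character cubic_character"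
  unfolding character_def
proof (intro conjI ballI)
  fix x y assume xy: "x \<in> K" "y \<in> K"
  show "cubic_character (x * y) = cubic_character x * cubic_character y"
  proof (cases "x = 0 \<or> y = 0")
    case False
    thus ?thesis
      using xy by (simp add: cubic_character_def power_mult_distrib mu3_embedding_mult power_s_mem_mu3)
  qed (use s_pos in \<open>auto simp: cubic_character_def power_0_left\<close>)
qed (use s_pos in \<open>simp_all add: cubic_character_def power_0_left\<close>)

lemma nontrivial_cubic_character:
  "nontrivial_character cubic_character"
  "nontrivial_character (\<lambda>x. cubic_character x * cubic_character x)"
proof -
  obtain y where "y \<in> K" "y \<noteq> 0" "y ^ s = w"
    using ex_power_eq[OF card_minus_1(1), of w] by (auto simp: mu3_eq)
  hence "y \<in> K - {0}" "cubic_character y = zeta3" by (simp_all add: cubic_character_def)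
  moreover have "character (\<lambda>x. cubic_character x * cubic_character x)"
    using character_cubic_character by (auto simp: character_def)
  ultimately show "nontrivial_character cubic_character"
    "nontrivial_character (\<lambda>x. cubic_character x * cubic_character x)"
    using character_cubic_character unfolding nontrivial_character_def
    by (metis zeta3_simps(1,5,6))+
qed

lemma jacobi_sum_cubic_character:
  "jacobi_sum cubic_character cubic_character = of_nat (jacobi_count 1)
    + of_nat (jacobi_count w) * zeta3 + of_nat (jacobi_count (w ^ 2)) * cnj zeta3"
proof -
  have "jacobi_sum cubic_character cubic_character = (\<Sum>x\<in>K. mu3_embedding ((x * (1 - x)) ^ s))"
    unfolding jacobi_sum_def using character_cubic_character
    by (intro sum.cong) (simp_all add: character_mult[symmetric] cubic_character_def[symmetric])
  thus ?thesis using sum_mult_one_minus_power_s[of mu3_embedding] by (simp add: sum_mu3)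
qed

theorem four_card_eq:
  "4 * int (card K) = jacobi_trace ^ 2 + 27 * (int (cyc_num 1 w) - int (cyc_num 1 (w ^ 2))) ^ 2"
proof -
  let ?J = "jacobi_sum cubic_character cubic_character"
  let ?B = "real (cyc_num 1 w) - real (cyc_num 1 (w ^ 2))"
  have "2 * Re ?J = of_int jacobi_trace"
    by (simp add: jacobi_sum_cubic_character jacobi_trace_def zeta3_def field_simps)
  moreover have "2 * Im ?J = 3 * sqrt 3 * ?B"
    by (simp add: jacobi_sum_cubic_character jacobi_count_w jacobi_count_w_square zeta3_def field_simps)
  moreover have "4 * real (card K) = (2 * Re ?J)\<^sup>2 + (2 * Im ?J)\<^sup>2"
    using arg_cong[OF jacobi_sum_mult_cnj[OF nontrivial_cubic_character(1,1,2)], of Re]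
    by (simp add: power2_eq_square)
  ultimately have "4 * real (card K) = (of_int jacobi_trace)\<^sup>2 + 27 * ?B\<^sup>2"
    by (simp add: power_mult_distrib)
  hence "real_of_int (4 * int (card K)) =
      of_int (jacobi_trace ^ 2 + 27 * (int (cyc_num 1 w) - int (cyc_num 1 (w ^ 2))) ^ 2)"
    by simp
  thus ?thesis by (simp only: of_int_eq_iff)
qed

section \<open>Counting the permutation binomials\<close>

definition induced_map :: "nat \<Rightarrow> 'a \<Rightarrow> 'a \<Rightarrow> 'a" where
  "induced_map n a z = z ^ n * (z + a) ^ s"

lemma induced_map_mem_mu3:
  assumes "a \<in> K" "z \<in> mu3" "z + a \<noteq> 0"
  shows "induced_map n a z \<in> mu3"
  unfolding induced_map_def using assms
  by (intro roots_of_unity_mult roots_of_unity_power power_s_mem_mu3) (auto simp: roots_of_unity_def)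

lemma induced_map_notin_mu3:
  assumes "z + a = 0"
  shows "induced_map n a z \<notin> mu3"
  using assms s_pos by (simp add: induced_map_def roots_of_unity_def power_0_left)

lemma prod_mu3: "(\<Prod>z\<in>mu3. f z) = f 1 * f w * f (w ^ 2)"
  unfolding mu3_eq by (simp add: mult.assoc)

lemma prod_mu3_add: "(\<Prod>z\<in>mu3. z + a) = 1 + a ^ 3"
proof -
  have "1 + w + w ^ 2 = 0" by (simp add: w_square_eq)
  moreover have "(1 + a) * (w + a) * (w ^ 2 + a) =
      1 + (1 + w + w ^ 2) * a + (1 + w + w ^ 2) * a ^ 2 + a ^ 3"
    by (simp add: algebra_simps power2_eq_square[of a] power3_eq_cube[of a])
  ultimately show ?thesis by (simp add: prod_mu3)
qed

lemma prod_induced_map: "(\<Prod>z\<in>mu3. induced_map n a z) = (1 + a ^ 3) ^ s"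
proof -
  have "(\<Prod>z\<in>mu3. z) = 1" by (simp add: prod_mu3)
  thus ?thesis
    by (simp add: induced_map_def prod.distrib prod_mu3_add flip: prod_power_distrib)
qed

lemma mult_mu3_eq_1_iff:
  assumes "x \<in> mu3" "y \<in> mu3" "z \<in> mu3"
  shows "x * y * z = 1 \<longleftrightarrow> (x \<noteq> y \<and> x \<noteq> z \<and> y \<noteq> z) \<or> (x = y \<and> x = z)"
  using assms unfolding mu3_eq by auto

definition permuting_set :: "nat \<Rightarrow> 'a set" where
  "permuting_set n = {a \<in> K. bij_betw (induced_map n a) mu3 mu3}"

definition collapsing_set :: "nat \<Rightarrow> 'a set" where
  "collapsing_set n = {a \<in> K. \<exists>c\<in>mu3. \<forall>z\<in>mu3. induced_map n a z = c}"

lemma bij_betw_binomial_iff: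
  assumes "n > 0" "coprime n s" "a \<in> K"
  shows "bij_betw (\<lambda>x. x ^ n * (x ^ s + a)) K K \<longleftrightarrow> a \<in> permuting_set n"
  using bij_betw_power_mult_iff[OF card_minus_1(1) assms(1,2), of "\<lambda>z. z + a"] assms
  by (simp add: permuting_set_def induced_map_def[abs_def] roots_of_unity_def)

lemma one_plus_cube_power_s_eq_1_iff:
  assumes "a \<in> K"
  shows "(1 + a ^ 3) ^ s = 1 \<longleftrightarrow> a \<in> permuting_set n \<union> collapsing_set n"
proof (cases "1 + a ^ 3 = 0")
  case True
  then obtain z where "z \<in> mu3" "z + a = 0" by (auto simp flip: prod_mu3_add)
  hence z: "z \<in> mu3" "induced_map n a z \<notin> mu3" by (simp_all add: induced_map_notin_mu3)
  hence "a \<notin> permuting_set n" by (auto simp: permuting_set_def dest: bij_betw_apply)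
  moreover have "a \<notin> collapsing_set n" using z unfolding collapsing_set_def by force
  ultimately have "a \<notin> permuting_set n \<union> collapsing_set n" by blast
  thus ?thesis using True s_pos by (simp add: power_0_left)
next
  case False
  let ?u = "induced_map n a"
  have mem: "?u z \<in> mu3" if "z \<in> mu3" for z
    using False that assms by (intro induced_map_mem_mu3) (auto simp flip: prod_mu3_add)
  have "(1 + a ^ 3) ^ s = 1 \<longleftrightarrow> ?u 1 * ?u w * ?u (w ^ 2) = 1"
    by (simp only: prod_mu3 flip: prod_induced_map[of n a])
  also have "\<dots> \<longleftrightarrow> (?u 1 \<noteq> ?u w \<and> ?u 1 \<noteq> ?u (w ^ 2) \<and> ?u w \<noteq> ?u (w ^ 2)) \<or>
      (?u 1 = ?u w \<and> ?u 1 = ?u (w ^ 2))"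
    by (rule mult_mu3_eq_1_iff; rule mem; simp add: mu3_eq)
  also have "?u 1 \<noteq> ?u w \<and> ?u 1 \<noteq> ?u (w ^ 2) \<and> ?u w \<noteq> ?u (w ^ 2) \<longleftrightarrow> inj_on ?u mu3"
    by (auto simp: mu3_eq)
  also have "inj_on ?u mu3 \<longleftrightarrow> bij_betw ?u mu3 mu3"
    using endo_inj_surj[of mu3 ?u] mem
    by (auto simp only: bij_betw_def image_subset_iff finite_roots_of_unity)
  also have "?u 1 = ?u w \<and> ?u 1 = ?u (w ^ 2) \<longleftrightarrow> (\<exists>c\<in>mu3. \<forall>z\<in>mu3. ?u z = c)"
    using mem[of 1] by (auto simp: mu3_eq)
  finally show ?thesis using assms by (simp add: permuting_set_def collapsing_set_def)
qed

lemma card_one_plus_cube_power_s_eq_1: "card {a \<in> K. (1 + a ^ 3) ^ s = 1} = 1 + 3 * cyc_num 1 1"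
proof -
  let ?f = "\<lambda>a. - (a ^ 3)"
  let ?A = "{a \<in> K - {0}. ?f a \<in> cyc_set 1 1}"
  have "?f a \<in> cyc_set 1 1" if "a \<in> K" "a \<noteq> 0" "(1 + a ^ 3) ^ s = 1" for a
  proof -
    have "a ^ (3 * s) = 1" using power_card_minus_1[OF that(1,2)] by (simp only: card_minus_1(1))
    hence "?f a ^ s = 1" by (simp only: uminus_power_s power_mult)
    moreover have "1 + a ^ 3 \<noteq> 0" using that s_pos by (auto simp: power_0_left)
    hence "1 \<noteq> ?f a" by (metis eq_neg_iff_add_eq_0)
    ultimately show ?thesis using that by (simp add: cyc_set_def)
  qed
  hence split: "{a \<in> K. (1 + a ^ 3) ^ s = 1} = insert 0 ?A" by (auto simp: cyc_set_def)
  have "card {a \<in> ?A. ?f a = r} = 3" if r: "r \<in> cyc_set 1 1" for r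
  proof -
    have "{a \<in> ?A. ?f a = r} = {a \<in> K - {0}. a ^ 3 = - r}" using r by auto
    moreover have "- r \<in> roots_of_unity s"
      using r by (simp add: cyc_set_def roots_of_unity_def uminus_power_s)
    ultimately show ?thesis using card_power_fibre[OF card_minus_1(2), of "- r"] by simp
  qed
  moreover have "card ?A = (\<Sum>r\<in>cyc_set 1 1. card {a \<in> ?A. ?f a = r})"
    by (rule card_eq_sum_card_fibres) auto
  ultimately have "card ?A = 3 * cyc_num 1 1" by (simp add: cyc_num_def)
  thus ?thesis unfolding split by simp
qed

lemma card_permuting_set:
  "card (permuting_set n) + card (collapsing_set n) = 1 + 3 * cyc_num 1 1"
proof -
  have False if "bij_betw (induced_map n a) mu3 mu3" "\<forall>z\<in>mu3. induced_map n a z = c" for a c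
    using that inj_onD[OF bij_betw_imp_inj_on, of "induced_map n a" mu3 mu3 1 w] by (simp add: mu3_eq)
  hence "permuting_set n \<inter> collapsing_set n = {}"
    unfolding permuting_set_def collapsing_set_def by blast
  moreover have "finite (permuting_set n)" "finite (collapsing_set n)"
    by (simp_all add: permuting_set_def collapsing_set_def)
  moreover have "{a \<in> K. (1 + a ^ 3) ^ s = 1} = permuting_set n \<union> collapsing_set n"
    using one_plus_cube_power_s_eq_1_iff by (auto simp: permuting_set_def collapsing_set_def)
  ultimately show ?thesis
    using card_one_plus_cube_power_s_eq_1 by (simp add: card_Un_disjoint)
qed

text \<open>For \<open>X = a + 1\<close>, \<open>Y = w (a + w)\<close> and \<open>Z = w\<^sup>2 (a + w\<^sup>2)\<close> we have \<open>X + Y + Z = 0\<close>, so that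
  \<open>r = - X / Y\<close> satisfies \<open>1 - r = - Z / Y\<close>. The induced map is constant iff \<open>r ^ s\<close> and
  \<open>(1 - r) ^ s\<close> have prescribed values. The value \<open>r = - w\<^sup>2\<close> corresponds to \<open>a = \<infinity>\<close>.\<close>

definition moebius :: "'a \<Rightarrow> 'a" where
  "moebius a = - ((a + 1) / (w * (a + w)))"

lemma one_minus_moebius:
  assumes "a + w \<noteq> 0"
  shows "1 - moebius a = - (w ^ 2 * (a + w ^ 2) / (w * (a + w)))"
proof -
  have "1 - moebius a = (w * (a + w) + (a + 1)) / (w * (a + w))"
    using assms by (simp add: moebius_def add_divide_distrib)
  also have "w * (a + w) + (a + 1) = - (w ^ 2 * (a + w ^ 2))"
    by (simp add: algebra_simps) (simp add: w_square_eq algebra_simps)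
  finally show ?thesis by simp
qed

lemma bij_betw_moebius: "bij_betw moebius (K - {- w}) (K - {- (w ^ 2)})"
proof -
  have denominator: "a + w \<noteq> 0" if "a \<in> K - {- w}" for a
    using that by (auto simp: add_eq_0_iff2)
  have "inj_on moebius (K - {- w})"
  proof (rule inj_onI)
    fix a b assume ab: "a \<in> K - {- w}" "b \<in> K - {- w}" "moebius a = moebius b"
    hence "(a + 1) * (b + w) = (b + 1) * (a + w)"
      using denominator by (simp add: moebius_def frac_eq_eq)
    hence "(w - 1) * (a - b) = 0" by (simp add: algebra_simps)
    thus "a = b" by simp
  qed
  moreover have "moebius ` (K - {- w}) \<subseteq> K - {- (w ^ 2)}"
  proof (rule image_subsetI)
    fix a assume a: "a \<in> K - {- w}"
    have "moebius a \<noteq> - (w ^ 2)"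
    proof
      assume "moebius a = - (w ^ 2)"
      hence "a + 1 = w ^ 2 * w * (a + w)"
        using denominator[OF a] by (simp add: moebius_def divide_eq_eq mult.assoc del: w_power_simps)
      thus False by simp
    qed
    thus "moebius a \<in> K - {- (w ^ 2)}" using a by (simp add: moebius_def)
  qed
  ultimately show ?thesis
    by (simp add: bij_betw_def card_subset_eq card_image)
qed

lemma induced_map_values:
  fixes n :: nat
  defines "c \<equiv> w ^ (n + 2 * s)"
  shows "induced_map n a 1 = (a + 1) ^ s"
    and "induced_map n a w = c * (w * (a + w)) ^ s"
    and "induced_map n a (w ^ 2) = c ^ 2 * (w ^ 2 * (a + w ^ 2)) ^ s"
proof -
  have "c * w ^ s = w ^ (3 * s) * w ^ n" by (simp add: c_def flip: power_add)
  hence w_power_n: "c * w ^ s = w ^ n" by (simp add: power_mult w_cubed)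
  have "(w ^ 2) ^ m = (w ^ m) ^ 2" for m by (simp add: mult.commute flip: power_mult)
  hence "c ^ 2 * (w ^ 2) ^ s = (w ^ 2) ^ n" by (simp only: w_power_n flip: power_mult_distrib)
  with w_power_n show "induced_map n a 1 = (a + 1) ^ s"
    "induced_map n a w = c * (w * (a + w)) ^ s"
    "induced_map n a (w ^ 2) = c ^ 2 * (w ^ 2 * (a + w ^ 2)) ^ s"
    by (simp_all add: induced_map_def power_mult_distrib add.commute flip: mult.assoc)
qed

lemma mem_collapsing_set_iff:
  fixes n :: nat
  assumes "a \<in> K" "a + w \<noteq> 0"
  defines "c \<equiv> w ^ (n + 2 * s)"
  shows "a \<in> collapsing_set n \<longleftrightarrow> moebius a \<in> cyc_set c (c ^ 2)"
proof -
  have c: "c \<in> mu3" "c \<noteq> 0" by (simp_all add: c_def w_power_mem_mu3)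
  define X Y Z where XYZ: "X = (a + 1) ^ s" "Y = (w * (a + w)) ^ s" "Z = (w ^ 2 * (a + w ^ 2)) ^ s"
  have Y: "Y \<in> mu3" "Y \<noteq> 0" using assms(1,2) by (auto simp: XYZ intro: power_s_mem_mu3)
  have "induced_map n a 1 = X" "induced_map n a w = c * Y" "induced_map n a (w ^ 2) = c ^ 2 * Z"
    unfolding XYZ c_def by (rule induced_map_values)+
  hence "a \<in> collapsing_set n \<longleftrightarrow> X \<in> mu3 \<and> X = c * Y \<and> X = c ^ 2 * Z"
    using assms(1) by (auto simp: collapsing_set_def mu3_eq)
  also have "\<dots> \<longleftrightarrow> X = c * Y \<and> c * Y = c ^ 2 * Z"
    using roots_of_unity_mult[OF c(1) Y(1)] by auto
  also have "c * Y = c ^ 2 * Z \<longleftrightarrow> Z = c ^ 2 * Y"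
  proof -
    have "c ^ 3 = 1" using c(1) by (simp add: roots_of_unity_def)
    have "c * Y = c ^ 2 * Z \<longleftrightarrow> Y = c * Z"
      using c(2) by (simp add: power2_eq_square mult.assoc)
    also have "\<dots> \<longleftrightarrow> c ^ 2 * Y = c ^ 3 * Z"
      using c(2) by (simp add: power2_eq_square power3_eq_cube mult.assoc)
    finally show ?thesis unfolding \<open>c ^ 3 = 1\<close> by auto
  qed
  also have "X = c * Y \<and> Z = c ^ 2 * Y \<longleftrightarrow> moebius a \<in> cyc_set c (c ^ 2)"
  proof -
    have power: "moebius a ^ s = X / Y" "(1 - moebius a) ^ s = Z / Y"
      using one_minus_moebius[OF assms(2)] by (simp_all add: moebius_def uminus_power_s XYZ power_divide)
    have "moebius a \<noteq> 0 \<and> moebius a \<noteq> 1" if "X / Y = c" "Z / Y = c ^ 2"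
      using that c s_pos power by (auto simp: power_0_left)
    moreover have "moebius a \<in> K" using assms(1) by (simp add: moebius_def)
    ultimately show ?thesis using Y(2) by (auto simp: cyc_set_def power divide_eq_eq)
  qed
  finally show ?thesis .
qed

lemma minus_w_square_mem_cyc_set_iff:
  fixes n :: nat
  defines "c \<equiv> w ^ (n + 2 * s)"
  shows "- (w ^ 2) \<in> cyc_set c (c ^ 2) \<longleftrightarrow> 3 dvd n"
proof -
  have one_minus: "1 - (- (w ^ 2)) = - w" by (simp add: w_square_eq)
  hence "- (w ^ 2) \<noteq> 1" by (metis diff_self neg_equal_0_iff_equal w_distinct(1))
  hence "- (w ^ 2) \<in> cyc_set c (c ^ 2) \<longleftrightarrow> (- (w ^ 2)) ^ s = c \<and> (- w) ^ s = c ^ 2"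
    using one_minus by (simp add: cyc_set_def)
  also have "\<dots> \<longleftrightarrow> w ^ (2 * s) = w ^ n * w ^ (2 * s) \<and> w ^ s = (w ^ n) ^ 2 * (w ^ (3 * s) * w ^ s)"
    unfolding uminus_power_s c_def by (simp add: mult.commute flip: power_mult power_add)
  also have "\<dots> \<longleftrightarrow> w ^ n = 1" by (auto simp: power_mult w_cubed)
  also have "\<dots> \<longleftrightarrow> 3 dvd n" by (rule w_power_eq_1_iff)
  finally show ?thesis .
qed

lemma card_collapsing_set:
  "card (collapsing_set n) + (if 3 dvd n then 1 else 0) =
    cyc_num 1 1 + (if 3 dvd n + 2 * s then 0 else 1)"
proof -
  define c where "c = w ^ (n + 2 * s)"
  have "a \<in> collapsing_set n \<longleftrightarrow> a \<in> K - {- w} \<and> moebius a \<in> cyc_set c (c ^ 2)" for a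
  proof (cases "a \<in> K - {- w}")
    case True
    hence "a \<in> K" "a + w \<noteq> 0" by (simp_all add: eq_neg_iff_add_eq_0)
    thus ?thesis using True mem_collapsing_set_iff[of a n] by (simp add: c_def)
  next
    case False
    thus ?thesis
      using induced_map_notin_mu3[of w a n] by (auto simp: collapsing_set_def mu3_eq)
  qed
  hence "collapsing_set n = {a \<in> K - {- w}. moebius a \<in> cyc_set c (c ^ 2)}" by blast
  also have "bij_betw moebius \<dots> (cyc_set c (c ^ 2) - {- (w ^ 2)})"
  proof (rule bij_betw_subset[OF bij_betw_moebius])
    have "moebius ` {a \<in> K - {- w}. moebius a \<in> cyc_set c (c ^ 2)} =
        moebius ` (K - {- w}) \<inter> cyc_set c (c ^ 2)" by auto
    also have "\<dots> = cyc_set c (c ^ 2) - {- (w ^ 2)}"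
      unfolding bij_betw_imp_surj_on[OF bij_betw_moebius] by (auto simp: cyc_set_def)
    finally show "moebius ` {a \<in> K - {- w}. moebius a \<in> cyc_set c (c ^ 2)} =
      cyc_set c (c ^ 2) - {- (w ^ 2)}" .
  qed blast
  finally have "card (collapsing_set n) = card (cyc_set c (c ^ 2) - {- (w ^ 2)})"
    by (rule bij_betw_same_card)
  hence "card (collapsing_set n) + (if 3 dvd n then 1 else 0) = cyc_num c (c ^ 2)"
    using minus_w_square_mem_cyc_set_iff[of n] card_gt_0_iff[of "cyc_set c (c ^ 2)"]
    by (auto simp: cyc_num_def c_def card_Diff_singleton_if)
  also have "\<dots> = cyc_num 1 1 + (if c = 1 then 0 else 1)"
    using w_power_mem_mu3[of "n + 2 * s"] unfolding mu3_eq c_def[symmetric]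
    by (auto simp: cyc_num_w_w_square)
  finally show ?thesis by (simp add: c_def w_power_eq_1_iff)
qed

theorem card_permutation_binomials:
  assumes "n > 0" "coprime n s"
  shows "9 * int (card {a \<in> K. bij_betw (\<lambda>x. x ^ n * (x ^ s + a)) K K}) =
    2 * int (card K) - 3 * ((if [n = s] (mod 3) then - 2 else 1) + (if 3 dvd n then - 2 else 1))
    - 10 + 2 * jacobi_trace"
proof -
  have "{a \<in> K. bij_betw (\<lambda>x. x ^ n * (x ^ s + a)) K K} = permuting_set n"
    using bij_betw_binomial_iff[OF assms] by (auto simp: permuting_set_def)
  moreover have "[n = s] (mod 3) \<longleftrightarrow> 3 dvd n + 2 * s" unfolding cong_def by presburger
  ultimately show ?thesis
    using card_permuting_set[of n] card_collapsing_set[of n] jacobi_trace_eq_cyc_num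
    by (simp split: if_splits)
qed

end

section \<open>Binomial coefficients modulo a prime\<close>

lemma choose_prime_add_cong:
  assumes "prime (p::nat)"
  shows "[(p + n) choose k = (n choose k) + (if p \<le> k then n choose (k - p) else 0)] (mod p)"
proof -
  have p: "p > 0" using assms prime_gt_0_nat by blast
  have "[(\<Sum>i\<le>k. (p choose i) * (n choose (k - i))) =
      (\<Sum>i\<le>k. (if i = 0 then n choose k else 0) + (if i = p then n choose (k - p) else 0))] (mod p)"
  proof (rule cong_sum)
    fix i assume "i \<in> {..k}"
    show "[(p choose i) * (n choose (k - i)) =
      (if i = 0 then n choose k else 0) + (if i = p then n choose (k - p) else 0)] (mod p)"
    proof (cases "i = 0 \<or> i \<ge> p")
      case True
      thus ?thesis using p by (cases "i = p") (auto simp: binomial_eq_0)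
    next
      case False
      hence "p dvd (p choose i)" using assms by (intro dvd_choose_prime) auto
      thus ?thesis using False by (simp add: cong_0_iff)
    qed
  qed
  thus ?thesis by (simp add: vandermonde sum.distrib sum.delta)
qed

theorem lucas_choose_cong:
  assumes "prime (p::nat)" "b < p" "d < p"
  shows "[(p * a + b) choose (p * c + d) = (a choose c) * (b choose d)] (mod p)"
proof (induction a arbitrary: c)
  case 0
  have "b choose (p * c + d) = 0" if "c > 0"
  proof -
    have "p * 1 \<le> p * c" using that by (intro mult_le_mono2) simp
    thus ?thesis using assms by (intro binomial_eq_0) linarith
  qed
  thus ?case by (cases "c = 0") (auto simp: binomial_eq_0)
next
  case (Suc a)
  have pascal: "[(p * Suc a + b) choose j =
      ((p * a + b) choose j) + (if p \<le> j then (p * a + b) choose (j - p) else 0)] (mod p)" for j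
    using choose_prime_add_cong[OF assms(1), of "p * a + b" j] by (simp add: add.assoc)
  show ?case
  proof (cases c)
    case 0
    thus ?thesis using pascal[of d] Suc.IH[of 0] assms by (auto intro: cong_trans)
  next
    case (Suc c')
    have "[(p * Suc a + b) choose (p * c + d) =
        ((p * a + b) choose (p * c + d)) + ((p * a + b) choose (p * c' + d))] (mod p)"
      using pascal[of "p * c + d"] by (simp add: Suc)
    also have "[((p * a + b) choose (p * c + d)) + ((p * a + b) choose (p * c' + d)) =
        (a choose c) * (b choose d) + (a choose c') * (b choose d)] (mod p)"
      by (intro cong_add Suc.IH)
    also have "(a choose c) * (b choose d) + (a choose c') * (b choose d) = (Suc a choose c) * (b choose d)"
      by (simp add: Suc algebra_simps)
    finally show ?thesis .
  qed
qed

lemma prime_not_dvd_choose: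
  assumes "prime (p::nat)" "n < p" "k \<le> n"
  shows "\<not> p dvd (n choose k)"
proof
  assume "p dvd (n choose k)"
  hence "p dvd fact n" using binomial_fact_lemma[OF assms(3)] by (metis dvd_mult)
  thus False using assms prime_dvd_fact_iff by force
qed

lemma prime_not_dvd_choose_repdigit:
  fixes p :: nat
  assumes "prime p" "e \<le> d" "d < p"
  shows "\<not> p dvd ((d * (\<Sum>i<k. p ^ i)) choose (e * (\<Sum>i<k. p ^ i)))"
proof (induction k)
  case 0
  show ?case using assms(1) by auto
next
  case (Suc k)
  have "(\<Sum>i<Suc k. p ^ i) = p * (\<Sum>i<k. p ^ i) + 1"
    unfolding sum.lessThan_Suc_shift by (simp add: sum_distrib_left)
  hence "a * (\<Sum>i<Suc k. p ^ i) = p * (a * (\<Sum>i<k. p ^ i)) + a" for a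
    by (simp add: algebra_simps)
  hence "[(d * (\<Sum>i<Suc k. p ^ i)) choose (e * (\<Sum>i<Suc k. p ^ i)) =
      ((d * (\<Sum>i<k. p ^ i)) choose (e * (\<Sum>i<k. p ^ i))) * (d choose e)] (mod p)"
    using lucas_choose_cong[OF assms(1), of d e] assms(2,3) by simp
  moreover have "\<not> p dvd (d choose e)" using assms by (intro prime_not_dvd_choose)
  ultimately show ?case
    using Suc.IH assms(1) by (simp add: cong_dvd_iff prime_dvd_mult_iff)
qed

lemma prime_not_dvd_choose_third:
  assumes "prime (p::nat)" "p mod 3 = 1"
  shows "\<not> p dvd ((2 * ((p ^ k - 1) div 3)) choose ((p ^ k - 1) div 3))"
proof -
  define m where "m = p div 3"
  have p: "p = 3 * m + 1" using assms(2) unfolding m_def by presburger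
  have "p ^ k = 3 * (m * (\<Sum>i<k. p ^ i)) + 1"
    by (induction k) (simp_all add: p algebra_simps)
  hence "(p ^ k - 1) div 3 = m * (\<Sum>i<k. p ^ i)" by simp
  thus ?thesis
    using prime_not_dvd_choose_repdigit[OF assms(1), of m "2 * m" k] p by (simp add: mult.assoc)
qed

text \<open>The factor \<open>n + j\<close> is half of \<open>2 j - 1\<close> modulo \<open>2 n + 1\<close>.\<close>

lemma fact_add_cong:
  fixes n :: nat
  shows "[4 ^ j * fact j * fact (n + j) = fact n * fact (2 * j)] (mod 2 * n + 1)"
proof (induction j)
  case 0
  show ?case by simp
next
  case (Suc j)
  have "4 ^ Suc j * fact (Suc j) * fact (n + Suc j) =
      (2 * (j + 1) * ((2 * n + 1) + (2 * j + 1))) * (4 ^ j * fact j * fact (n + j) :: nat)"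
    by (simp add: algebra_simps)
  also have "[\<dots> = (2 * (j + 1) * (0 + (2 * j + 1))) * (fact n * fact (2 * j))] (mod 2 * n + 1)"
    by (intro cong_mult cong_add Suc.IH cong_refl) (simp add: cong_0_iff)
  also have "(2 * (j + 1) * (0 + (2 * j + 1))) * (fact n * fact (2 * j)) =
      fact n * (fact (2 * Suc j) :: nat)"
    by (simp add: algebra_simps)
  finally show ?case .
qed

lemma four_power_mult_choose_cong:
  fixes m :: nat
  assumes "prime (6 * m + 1)"
  shows "[4 ^ m * ((4 * m) choose (2 * m)) = (3 * m) choose (2 * m)] (mod 6 * m + 1)"
proof -
  let ?c = "fact m * fact (2 * m) * fact (2 * m) :: nat"
  have "coprime (fact n) (6 * m + 1)" if "n \<le> 2 * m" for n :: nat
  proof -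
    have "\<not> (6 * m + 1) dvd fact n" using assms that by (subst prime_dvd_fact_iff) auto
    thus ?thesis using assms prime_imp_coprime coprime_commute by blast
  qed
  hence coprime: "coprime ?c (6 * m + 1)" by (simp del: One_nat_def)
  have "fact (4 * m) = ((4 * m) choose (2 * m)) * fact (2 * m) * (fact (2 * m) :: nat)"
    using binomial_fact_lemma[of "2 * m" "4 * m"] by (simp add: mult_ac)
  hence "?c * (4 ^ m * ((4 * m) choose (2 * m))) = 4 ^ m * fact m * fact (3 * m + m)"
    by (simp add: mult_ac)
  also have "[\<dots> = fact (3 * m) * fact (2 * m)] (mod 6 * m + 1)"
    using fact_add_cong[of m "3 * m"] by simp
  also have "fact (3 * m) * fact (2 * m) = ?c * ((3 * m) choose (2 * m))"
    using binomial_fact_lemma[of "2 * m" "3 * m"] by (simp add: mult_ac)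
  finally show ?thesis using cong_mult_lcancel_nat[OF coprime] by blast
qed

section \<open>The form \<open>A\<^sup>2 + 27 B\<^sup>2\<close>\<close>

text \<open>Multiplying the two representations gives
  \<open>(A C + d B D)\<^sup>2 + d (A D - B C)\<^sup>2 = c\<^sup>2 p\<^sup>2\<^sup>k\<close>, which leaves no room for a nonzero multiple
  \<open>A D - B C\<close> of \<open>p ^ k\<close>.\<close>

lemma norm_form_square_eq_if_dvd:
  fixes A B C D c d P :: int
  assumes "0 < c" "c ^ 2 < d" "0 < P"
    and AB: "A ^ 2 + d * B ^ 2 = c * P" and CD: "C ^ 2 + d * D ^ 2 = c * P"
    and "P dvd A * D - B * C"
  shows "A ^ 2 = C ^ 2"
proof -
  obtain t where t: "A * D - B * C = P * t" using assms(6) by (auto elim: dvdE)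
  have "(A * C + d * (B * D)) ^ 2 + d * (A * D - B * C) ^ 2 =
      (A ^ 2 + d * B ^ 2) * (C ^ 2 + d * D ^ 2)"
    by (simp add: power2_eq_square algebra_simps)
  hence "(A * C + d * (B * D)) ^ 2 + (d * t ^ 2) * P ^ 2 = c ^ 2 * P ^ 2"
    unfolding t AB CD by (simp add: power2_eq_square algebra_simps)
  hence "(d * t ^ 2) * P ^ 2 \<le> c ^ 2 * P ^ 2"
    using zero_le_power2[of "A * C + d * (B * D)"] by linarith
  hence "d * t ^ 2 < d * 1" using assms(2,3) by simp
  moreover have "0 < d" using assms(2) zero_le_power2[of c] by linarith
  ultimately have "t ^ 2 < 1" by (simp only: mult_less_cancel_left_pos)
  hence "t ^ 2 \<le> 0" by linarith
  hence cross: "A * D = B * C" using t by simp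
  have "A ^ 2 * (C ^ 2 + d * D ^ 2) = A ^ 2 * C ^ 2 + d * (A * D) ^ 2"
    by (simp add: power2_eq_square algebra_simps)
  also have "\<dots> = C ^ 2 * (A ^ 2 + d * B ^ 2)"
    unfolding cross by (simp add: power2_eq_square algebra_simps)
  finally show ?thesis unfolding AB CD using assms(1,3) by simp
qed

lemma prime_power_dvd_cross_term:
  fixes p A B C D c d :: int
  assumes "prime p" "p \<noteq> 2" "\<not> p dvd A" "\<not> p dvd C"
    and AB: "A ^ 2 + d * B ^ 2 = c * p ^ k" and CD: "C ^ 2 + d * D ^ 2 = c * p ^ k"
  shows "p ^ k dvd A * D - B * C \<or> p ^ k dvd A * D + B * C"
proof (cases "k = 0")
  case False
  have squares: "A ^ 2 = c * p ^ k - d * B ^ 2" "C ^ 2 = c * p ^ k - d * D ^ 2"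
    using AB CD by linarith+
  have "(A * D - B * C) * (A * D + B * C) = A ^ 2 * D ^ 2 - B ^ 2 * C ^ 2"
    by (simp add: power2_eq_square algebra_simps)
  also have "\<dots> = p ^ k * (c * (D ^ 2 - B ^ 2))"
    unfolding squares by (simp add: algebra_simps)
  finally have "p ^ k dvd (A * D - B * C) * (A * D + B * C)" by simp
  moreover have "\<not> (p dvd A * D - B * C \<and> p dvd A * D + B * C)"
  proof
    assume "p dvd A * D - B * C \<and> p dvd A * D + B * C"
    hence "p dvd (A * D - B * C) + (A * D + B * C)" by (blast intro: dvd_add)
    hence "p dvd 2 * (A * D)" by simp
    moreover have "\<not> p dvd 2" using assms(1,2) primes_dvd_imp_eq[of p 2] by auto
    ultimately have "p dvd D" using assms(1,3) by (auto simp: prime_dvd_mult_iff)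
    hence "p dvd C ^ 2" using False unfolding squares by (intro dvd_diff) (auto simp: power2_eq_square)
    thus False using assms(1,4) prime_dvd_power by blast
  qed
  hence "coprime (p ^ k) (A * D - B * C) \<or> coprime (p ^ k) (A * D + B * C)"
    using assms(1) prime_imp_coprime by (auto simp: coprime_power_left_iff)
  ultimately show ?thesis
    by (auto simp: coprime_dvd_mult_right_iff coprime_dvd_mult_left_iff)
qed simp

theorem norm_form_square_unique:
  fixes p A B C D c d :: int
  assumes "prime p" "p \<noteq> 2" "0 < c" "c ^ 2 < d" "\<not> p dvd A" "\<not> p dvd C"
    and AB: "A ^ 2 + d * B ^ 2 = c * p ^ k" and CD: "C ^ 2 + d * D ^ 2 = c * p ^ k"
  shows "A ^ 2 = C ^ 2"
proof -
  have "p ^ k > 0" using assms(1) prime_gt_0_int by simp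
  note unique = norm_form_square_eq_if_dvd[OF assms(3,4) this _ CD]
  have "p ^ k dvd A * D - B * C \<or> p ^ k dvd A * D - (- B) * C"
    using prime_power_dvd_cross_term[OF assms(1,2,5,6) AB CD] by simp
  moreover have "A ^ 2 + d * (- B) ^ 2 = c * p ^ k" using AB by simp
  ultimately show ?thesis using unique[OF AB] unique[of A "- B"] by blast
qed

corollary norm_form_27_unique:
  fixes p A B C D :: int
  assumes "prime p" "p \<noteq> 2" "\<not> p dvd A" "\<not> p dvd C" "A mod 3 = 1" "C mod 3 = 1"
    and "A ^ 2 + 27 * B ^ 2 = 4 * p ^ k" "C ^ 2 + 27 * D ^ 2 = 4 * p ^ k"
  shows "A = C"
proof -
  have "A ^ 2 = C ^ 2"
    using norm_form_square_unique[OF assms(1,2) _ _ assms(3,4,7,8)] by simp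
  hence "A = C \<or> A = - C" by (simp add: power2_eq_iff)
  thus ?thesis using assms(5,6) by presburger
qed

lemma fermat_theorem_int:
  fixes a :: int
  assumes "prime (p::nat)" "\<not> int p dvd a"
  shows "[a ^ (p - 1) = 1] (mod p)"
proof -
  define r where "r = nat (a mod p)"
  have r: "[int r = a] (mod p)" using assms(1) prime_gt_0_nat by (simp add: r_def cong_def)
  hence "\<not> p dvd r" using assms(2) cong_dvd_iff by (metis int_dvd_int_iff)
  hence "[r ^ (p - 1) = 1] (mod p)" by (rule fermat_theorem[OF assms(1)])
  hence "[int r ^ (p - 1) = 1] (mod p)" by (metis cong_int_iff of_nat_1 of_nat_power)
  thus ?thesis using cong_pow[OF r, of "p - 1"] cong_sym cong_trans by blast
qed

lemma cong_if_cube_cong: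
  fixes x y :: int
  assumes "prime (p::nat)" "p mod 3 = 2" "\<not> int p dvd x" "\<not> int p dvd y"
    and "[x ^ 3 = y ^ 3] (mod p)"
  shows "[x = y] (mod p)"
proof -
  define t where "t = p div 3"
  have t: "p - 1 = 3 * t + 1" using assms(2) unfolding t_def by presburger
  have "[x * 1 = x * y ^ (p - 1)] (mod p)"
    using fermat_theorem_int[OF assms(1,4)] by (intro cong_mult cong_refl) (rule cong_sym)
  also have "x * y ^ (p - 1) = x * (y ^ 3) ^ t * y" unfolding t by (simp add: power_mult)
  also have "[\<dots> = x * (x ^ 3) ^ t * y] (mod p)"
    by (intro cong_mult cong_refl cong_pow[OF cong_sym[OF assms(5)]])
  also have "x * (x ^ 3) ^ t * y = x ^ (p - 1) * y" unfolding t by (simp add: power_mult)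
  also have "[\<dots> = 1 * y] (mod p)"
    by (intro cong_mult cong_refl fermat_theorem_int assms)
  finally show ?thesis by simp
qed

lemma inert_prime_dvd_eisenstein_norm:
  fixes x y :: int
  assumes "prime (p::nat)" "p mod 3 = 2" "int p dvd x ^ 2 + x * y + y ^ 2"
  shows "int p dvd x" "int p dvd y"
proof -
  have p: "prime (int p)" using assms(1) by simp
  have "\<not> int p dvd 3" using p assms(2) primes_dvd_imp_eq[of "int p" 3] by auto
  have x_iff: "int p dvd x \<longleftrightarrow> int p dvd y"
  proof -
    have "int p dvd x \<Longrightarrow> int p dvd y ^ 2" "int p dvd y \<Longrightarrow> int p dvd x ^ 2"
      using assms(3) by (simp_all add: dvd_add_right_iff dvd_add_left_iff power2_eq_square)
    thus ?thesis using p prime_dvd_power by blast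
  qed
  show "int p dvd y"
  proof (rule ccontr)
    assume y: "\<not> int p dvd y"
    have "x ^ 3 - y ^ 3 = (x - y) * (x ^ 2 + x * y + y ^ 2)"
      by (simp add: power2_eq_square power3_eq_cube algebra_simps)
    hence "[x ^ 3 = y ^ 3] (mod p)" using assms(3) by (simp add: cong_iff_dvd_diff)
    hence "[x = y] (mod p)" using cong_if_cube_cong assms(1,2) x_iff y by blast
    hence "[x ^ 2 + x * y + y ^ 2 = y ^ 2 + y * y + y ^ 2] (mod p)"
      by (intro cong_add cong_mult cong_pow cong_refl)
    hence "int p dvd 3 * (y * y)"
      using assms(3) cong_dvd_iff by (simp add: power2_eq_square) blast
    thus False using y \<open>\<not> int p dvd 3\<close> by (simp add: prime_dvd_mult_iff[OF p])
  qed
  thus "int p dvd x" using x_iff by simp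
qed

lemma inert_prime_power_dvd_eisenstein_norm:
  fixes x y :: int
  assumes "prime (p::nat)" "p mod 3 = 2" "int p ^ (2 * j) dvd x ^ 2 + x * y + y ^ 2"
  shows "int p ^ j dvd x \<and> int p ^ j dvd y"
  using assms(3)
proof (induction j arbitrary: x y)
  case (Suc j)
  have "int p dvd x ^ 2 + x * y + y ^ 2" using Suc.prems by (auto dest: dvd_mult_left)
  then obtain x' y' where xy: "x = int p * x'" "y = int p * y'"
    using inert_prime_dvd_eisenstein_norm[OF assms(1,2)] by (meson dvdE)
  have "int p ^ 2 * int p ^ (2 * j) dvd int p ^ 2 * (x' ^ 2 + x' * y' + y' ^ 2)"
    using Suc.prems by (simp add: xy power2_eq_square algebra_simps)
  hence "int p ^ (2 * j) dvd x' ^ 2 + x' * y' + y' ^ 2"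
    using assms(1) prime_gt_0_nat[of p] by simp
  thus ?case using Suc.IH by (simp add: xy mult_dvd_mono)
qed simp

text \<open>Here \<open>A\<^sup>2 + 27 B\<^sup>2 = 4 (x\<^sup>2 + x y + y\<^sup>2)\<close> with \<open>y = 3 B\<close> and \<open>A = 2 x + y\<close>.\<close>

lemma inert_prime_power_dvd_norm_form:
  fixes A B :: int
  assumes "prime (p::nat)" "p mod 3 = 2" "A ^ 2 + 27 * B ^ 2 = 4 * int p ^ (2 * j)"
  shows "int p ^ j dvd A" "int p ^ j dvd B"
proof -
  have "even (A ^ 2 + 27 * B ^ 2)" unfolding assms(3) by simp
  hence "even (A - 3 * B)" by simp
  then obtain x where "A - 3 * B = 2 * x" by (elim evenE)
  hence A: "A = 2 * x + 3 * B" by simp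
  have "4 * (x ^ 2 + x * (3 * B) + (3 * B) ^ 2) = 4 * int p ^ (2 * j)"
    unfolding assms(3)[symmetric] A by (simp add: power2_eq_square algebra_simps)
  hence "x ^ 2 + x * (3 * B) + (3 * B) ^ 2 = int p ^ (2 * j)" by (simp only: mult_cancel_left) simp
  hence dvd: "int p ^ j dvd x" "int p ^ j dvd 3 * B"
    using inert_prime_power_dvd_eisenstein_norm[OF assms(1,2), of j x "3 * B"]
    by (simp_all only: dvd_refl)
  show "int p ^ j dvd A" unfolding A using dvd by (intro dvd_add) auto
  have "coprime (int p ^ j) 3"
    using assms(1,2) primes_coprime[of "int p" 3] by (cases "p = 3") (auto simp: coprime_power_left_iff)
  thus "int p ^ j dvd B" using dvd(2) coprime_dvd_mult_right_iff by blast
qed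

lemma inert_prime_power_norm_form:
  fixes A B :: int
  assumes "prime (p::nat)" "p mod 3 = 2" "A mod 3 = 1"
    and norm: "A ^ 2 + 27 * B ^ 2 = 4 * int p ^ (2 * j)"
  shows "A = - 2 * (- int p) ^ j"
proof -
  obtain a b where ab: "A = int p ^ j * a" "B = int p ^ j * b"
    using inert_prime_power_dvd_norm_form[OF assms(1,2) norm] by (meson dvdE)
  have "int p ^ (2 * j) * (a ^ 2 + 27 * b ^ 2) = int p ^ (2 * j) * 4"
    using norm by (simp add: ab power_mult_distrib algebra_simps flip: power_mult)
  hence "a ^ 2 + 27 * b ^ 2 = 4" using assms(1) prime_gt_0_nat[of p] by simp
  hence "b ^ 2 \<le> 0" using zero_le_power2[of a] by linarith
  hence "B = 0" by (simp add: ab)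
  define e where "e = (- int p) ^ j"
  have "e ^ 2 = int p ^ (2 * j)"
    unfolding e_def by (metis mult.commute power2_minus power_mult)
  hence "A ^ 2 = (2 * e) ^ 2"
    using norm \<open>B = 0\<close> by (simp add: power_mult_distrib)
  hence "A = 2 * e \<or> A = - (2 * e)" by (simp only: power2_eq_iff)
  moreover have "A \<noteq> 2 * e"
  proof -
    have "(- int p) mod 3 = 1" using assms(2) by presburger
    hence "e mod 3 = 1" using power_mod[of "- int p" 3 j] by (simp add: e_def)
    thus ?thesis using assms(3) by presburger
  qed
  ultimately show ?thesis by (simp add: e_def)
qed

section \<open>Identification of the Jacobi trace\<close>

text \<open>A root of \<open>X\<^sup>2 + A X + (A\<^sup>2 + 27 B\<^sup>2) / 4\<close>.\<close>

definition norm_form_root :: "int \<Rightarrow> int \<Rightarrow> complex" where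
  "norm_form_root A B = Complex (- of_int A / 2) (3 * sqrt 3 * of_int B / 2)"

lemma norm_form_root_add_cnj: "norm_form_root A B + cnj (norm_form_root A B) = - of_int A"
  by (simp add: norm_form_root_def complex_eq_iff)

lemma norm_form_root_mult_cnj:
  "4 * (norm_form_root A B * cnj (norm_form_root A B)) = of_int (A ^ 2 + 27 * B ^ 2)"
  by (simp add: norm_form_root_def complex_eq_iff power2_eq_square field_simps)

lemma norm_form_root_linear:
  "of_int u * norm_form_root A B + of_int v * norm_form_root C D =
    norm_form_root (u * A + v * C) (u * B + v * D)"
  by (simp add: norm_form_root_def complex_eq_iff field_simps)

lemma norm_form_root_power:
  assumes "prime p" "p mod 3 = 1" "A mod 3 = 1" "\<not> int p dvd A"
    and norm: "A ^ 2 + 27 * B ^ 2 = 4 * int p"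
  shows "\<exists>C D. norm_form_root A B ^ k = norm_form_root C D \<and> C mod 3 = 1 \<and>
    (k > 0 \<longrightarrow> \<not> int p dvd C)"
proof (induction k rule: induct_nat_012)
  case 0
  have "norm_form_root (- 2) 0 = 1" by (simp add: norm_form_root_def complex_eq_iff)
  thus ?case by (intro exI[of _ "- 2"] exI[of _ 0]) simp
next
  case 1
  thus ?case using assms(3,4) by auto
next
  case (ge2 j)
  let ?z = "norm_form_root A B"
  obtain C D C' D' where CD: "?z ^ j = norm_form_root C D" "C mod 3 = 1"
    and CD': "?z ^ Suc j = norm_form_root C' D'" "C' mod 3 = 1" "\<not> int p dvd C'"
    using ge2 by blast
  have "?z * cnj ?z = of_int (int p)" using norm_form_root_mult_cnj[of A B] norm by simp
  moreover have "?z ^ Suc (Suc j) = (?z + cnj ?z) * ?z ^ Suc j - ?z * cnj ?z * ?z ^ j"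
    by (simp add: algebra_simps)
  ultimately have "?z ^ Suc (Suc j) = of_int (- A) * ?z ^ Suc j + of_int (- int p) * ?z ^ j"
    by (simp only: norm_form_root_add_cnj) simp
  hence "?z ^ Suc (Suc j) = norm_form_root (- A * C' + - int p * C) (- A * D' + - int p * D)"
    by (simp only: CD CD' norm_form_root_linear)
  moreover have "(- A * C' + - int p * C) mod 3 = 1"
  proof -
    have "[A = 1] (mod 3)" "[int p = 1] (mod 3)" "[C = 1] (mod 3)" "[C' = 1] (mod 3)"
      using assms(2,3) CD(2) CD'(2) zmod_int[of p 3] by (simp_all add: cong_def)
    hence "[- A * C' + - int p * C = - 1 * 1 + - 1 * 1] (mod 3)"
      by (intro cong_add cong_mult) (simp_all add: cong_minus_minus_iff)
    thus ?thesis by (simp add: cong_def)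
  qed
  moreover have "\<not> int p dvd - A * C' + - int p * C"
    using CD'(3) assms(1,4) by (simp add: dvd_diff_left_iff prime_dvd_mult_iff)
  ultimately show ?case by blast
qed

lemma norm_form_root_power_norm:
  assumes "norm_form_root A B ^ k = norm_form_root C D" "A ^ 2 + 27 * B ^ 2 = 4 * N"
  shows "C ^ 2 + 27 * D ^ 2 = 4 * N ^ k"
proof -
  have "norm_form_root A B * cnj (norm_form_root A B) = of_int N"
    using norm_form_root_mult_cnj[of A B] by (simp add: assms(2))
  hence "norm_form_root C D * cnj (norm_form_root C D) = of_int (N ^ k)"
    by (simp flip: assms(1) power_mult_distrib)
  hence "complex_of_int (C ^ 2 + 27 * D ^ 2) = of_int (4 * N ^ k)"
    unfolding norm_form_root_mult_cnj[symmetric] by simp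
  thus ?thesis by (simp only: of_int_eq_iff)
qed

lemma int_eq_if_cong_if_square_le:
  fixes x y m :: int
  assumes "[x = y] (mod m)" "x ^ 2 \<le> 4 * m" "y ^ 2 \<le> 4 * m" "16 < m"
  shows "x = y"
proof -
  have "(x - y) ^ 2 \<le> 2 * x ^ 2 + 2 * y ^ 2"
    using zero_le_power2[of "x + y"] by (simp add: power2_eq_square algebra_simps)
  also have "\<dots> \<le> 16 * m" using assms(2,3) by linarith
  also have "\<dots> < m ^ 2" using assms(4) by (simp add: power2_eq_square)
  finally have "\<bar>x - y\<bar> < m"
    using assms(4) power2_less_imp_less[of "\<bar>x - y\<bar>" m] by simp
  moreover have "m dvd x - y" using assms(1) by (simp add: cong_iff_dvd_diff)
  ultimately show ?thesis using dvd_imp_le_int[of "x - y" m] by force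
qed

lemma abs_le_two_mult_sqrt_iff:
  fixes k :: int and m :: nat
  shows "\<bar>real_of_int k\<bar> \<le> 2 * sqrt (real m) \<longleftrightarrow> k ^ 2 \<le> 4 * int m"
proof -
  have "\<bar>real_of_int k\<bar> \<le> 2 * sqrt (real m) \<longleftrightarrow> sqrt (real_of_int (k ^ 2)) \<le> sqrt (4 * real m)"
    by (simp add: real_sqrt_mult)
  also have "\<dots> \<longleftrightarrow> real_of_int (k ^ 2) \<le> real_of_int (4 * int m)"
    by (simp only: real_sqrt_le_iff) simp
  finally show ?thesis by (simp only: of_int_le_iff)
qed

lemma kappa_eqI_if_ge_19:
  fixes A :: int
  assumes "prime p" "p mod 3 = 1" "p \<ge> 19" "A ^ 2 \<le> 4 * int p"
    and cong: "[A = - int ((2 * ((p - 1) div 3)) choose ((p - 1) div 3))] (mod p)"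
  shows "kappa p = A"
proof -
  define m where "m = (p - 1) div 6"
  have "odd p" using assms(1,3) prime_odd_nat by force
  hence p: "p = 6 * m + 1" using assms(2) unfolding m_def by presburger
  have divs: "(p - 1) div 2 = 3 * m" "(p - 1) div 3 = 2 * m" "(p - 1) div 6 = m"
    using p by auto
  have A_cong: "[A * 4 ^ m = - int ((3 * m) choose (2 * m))] (mod p)"
  proof -
    have "2 * (2 * m) = 4 * m" by simp
    hence "[A * 4 ^ m = - int ((4 * m) choose (2 * m)) * 4 ^ m] (mod p)"
      using cong by (intro cong_mult cong_refl) (simp only: divs)
    also have "- int ((4 * m) choose (2 * m)) * 4 ^ m = - int (4 ^ m * ((4 * m) choose (2 * m)))"
      by simp
    also have "[\<dots> = - int ((3 * m) choose (2 * m))] (mod p)"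
      using four_power_mult_choose_cong[of m] assms(1) p
      by (simp only: cong_minus_minus_iff cong_int_iff)
    finally show ?thesis .
  qed
  have unique: "k = A"
    if "k ^ 2 \<le> 4 * int p" "[k * 4 ^ m = - int ((3 * m) choose (2 * m))] (mod p)" for k
  proof (rule int_eq_if_cong_if_square_le)
    have "coprime (2 ^ 2) (int p)" using \<open>odd p\<close> by (simp only: coprime_power_left_iff) simp
    hence "coprime (4 ^ m) (int p)" by (simp add: coprime_power_left_iff)
    moreover have "[k * 4 ^ m = A * 4 ^ m] (mod p)" using that(2) A_cong cong_sym cong_trans by blast
    ultimately show "[k = A] (mod p)" by (simp add: cong_mult_rcancel)
  qed (use that assms in simp_all)
  have "(THE k. k ^ 2 \<le> 4 * int p \<and> [k * 4 ^ m = - int ((3 * m) choose (2 * m))] (mod p)) = A"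
    by (rule the_equality) (use A_cong assms(4) unique in blast)+
  thus ?thesis using assms(2,3) unfolding kappa_def divs abs_le_two_mult_sqrt_iff by simp
qed

text \<open>The values at \<open>7\<close> and \<open>13\<close> come from \<open>1 + 27 = 4 * 7\<close> and \<open>25 + 27 = 4 * 13\<close>.\<close>

lemma kappa_eqI:
  fixes A B :: int
  assumes "prime p" "p mod 3 = 1" "A mod 3 = 1" "\<not> int p dvd A"
    and norm: "A ^ 2 + 27 * B ^ 2 = 4 * int p"
    and cong: "[A = - int ((2 * ((p - 1) div 3)) choose ((p - 1) div 3))] (mod p)"
  shows "kappa p = A"
proof -
  have unique: "A = C" if "C ^ 2 + 27 = 4 * int p" "C mod 3 = 1" "\<not> int p dvd C" for C
    using norm_form_27_unique[of "int p" A C B 1 1] assms that by force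
  have "even p \<Longrightarrow> p = 2" using assms(1) primes_dvd_imp_eq[of 2 p] two_is_prime_nat by metis
  hence "p \<noteq> 4" "p \<noteq> 10" "p \<noteq> 16" by auto
  moreover have "p \<noteq> 1" using assms(1) by auto
  ultimately have "p = 7 \<or> p = 13 \<or> p \<ge> 19" using assms(2) by presburger
  then consider "p = 7" | "p = 13" | "p \<ge> 19" by blast
  thus ?thesis
  proof cases
    case 1
    thus ?thesis using unique[of 1] by (simp add: kappa_def)
  next
    case 2
    thus ?thesis using unique[of "- 5"] by (simp add: kappa_def)
  next
    case 3
    have "A ^ 2 \<le> 4 * int p" using norm zero_le_power2[of B] by linarith
    thus ?thesis using kappa_eqI_if_ge_19[OF assms(1,2) 3 _ cong] by blast
  qed
qed

lemma finite_subfield_UNIV: "finite_subfield (UNIV :: 'a::{finite,field} set)"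
  by unfold_locales auto

lemma
  fixes p :: nat
  assumes "CHAR('a::field) = p" "p > 0"
  shows finite_subfield_range_of_int: "finite_subfield (range (of_int :: int \<Rightarrow> 'a))"
    and card_range_of_int: "card (range (of_int :: int \<Rightarrow> 'a)) = p"
proof -
  have eq_iff: "(of_int x :: 'a) = of_int y \<longleftrightarrow> x mod int p = y mod int p" for x y
    using of_int_eq_iff_cong_CHAR[where ?'a = 'a, of x y] assms by (simp add: cong_def)
  have "(of_int x :: 'a) \<in> of_int ` {0..<int p}" for x
  proof (rule image_eqI)
    show "(of_int x :: 'a) = of_int (x mod int p)" by (simp only: eq_iff mod_mod_trivial)
    show "x mod int p \<in> {0..<int p}" using assms(2) by simp
  qed
  hence range: "range (of_int :: int \<Rightarrow> 'a) = of_int ` {0..<int p}" by auto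
  moreover have "inj_on (of_int :: int \<Rightarrow> 'a) {0..<int p}"
    by (auto intro!: inj_onI simp: eq_iff)
  ultimately show "card (range (of_int :: int \<Rightarrow> 'a)) = p" by (simp add: card_image)
  show "finite_subfield (range (of_int :: int \<Rightarrow> 'a))"
  proof
    show "finite (range (of_int :: int \<Rightarrow> 'a))" by (simp add: range)
    show "1 \<in> range of_int" by (rule range_eqI[of _ _ 1]) simp
    show "x - y \<in> range of_int" "x * y \<in> range of_int"
      if "x \<in> range of_int" "y \<in> range of_int" for x y :: 'a
      using that by (auto simp flip: of_int_diff of_int_mult)
  qed
qed

context finite_subfield
begin

lemma CHAR_eq_if_card_eq_prime_power:
  assumes "prime p" "card K = p ^ k"
  shows "CHAR('a) = p"
proof -
  have "CHAR('a) dvd p ^ k"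
    using of_nat_card_eq_0 assms(2) by (simp only: of_nat_eq_0_iff_char_dvd)
  moreover have "prime CHAR('a)"
  proof (rule prime_CHAR_semidom)
    show "CHAR('a) > 0" using \<open>CHAR('a) dvd p ^ k\<close> assms(1) by (auto intro: Nat.gr0I)
  qed
  ultimately show ?thesis using assms(1) by (metis prime_dvd_power primes_dvd_imp_eq)
qed

lemma ex_cubic_subfield:
  assumes "card K mod 3 = 1"
  obtains w where "cubic_subfield K w ((card K - 1) div 3)"
proof -
  define s where "s = (card K - 1) div 3"
  have s: "card K = 3 * s + 1" using assms unfolding s_def by presburger
  hence "card (roots_of_unity 3) = 3" using card_roots_of_unity[of 3 s] by simp
  hence "\<not> roots_of_unity 3 \<subseteq> {1}" using card_mono[of "{1}" "roots_of_unity 3"] by auto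
  then obtain w where "w \<in> K" "w ^ 3 = 1" "w \<noteq> 1" by (auto simp: roots_of_unity_def)
  hence "cubic_subfield K w s" using s by unfold_locales
  thus ?thesis using that by (simp add: s_def)
qed

end

context cubic_subfield
begin

lemma prime_not_dvd_jacobi_trace:
  assumes "prime p" "p mod 3 = 1" "card K = p ^ k"
  shows "\<not> int p dvd jacobi_trace"
proof -
  have char: "CHAR('a) = p" by (rule CHAR_eq_if_card_eq_prime_power[OF assms(1,3)])
  have "s = (p ^ k - 1) div 3" using card_K assms(3) by simp
  hence "\<not> int p dvd - int ((2 * s) choose s)"
    using prime_not_dvd_choose_third[OF assms(1,2), of k] by simp
  thus ?thesis using jacobi_trace_cong unfolding char by (metis cong_dvd_iff)
qed

end

lemma pi_p_eq_norm_form_root: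
  assumes "prime p" "p mod 3 = 1" "CHAR('a::field) = p"
  obtains A B where "pi_p p = norm_form_root A B"
    "A ^ 2 + 27 * B ^ 2 = 4 * int p" "A mod 3 = 1" "\<not> int p dvd A"
proof -
  let ?P = "range (of_int :: int \<Rightarrow> 'a)"
  have p_pos: "p > 0" using assms(1) prime_gt_0_nat by blast
  have card_P: "card ?P = p" by (rule card_range_of_int[OF assms(3) p_pos])
  interpret P: finite_subfield ?P by (rule finite_subfield_range_of_int[OF assms(3) p_pos])
  obtain v where "cubic_subfield ?P v ((p - 1) div 3)"
    using P.ex_cubic_subfield card_P assms(2) by auto
  then interpret P: cubic_subfield ?P v "(p - 1) div 3" .
  define B where "B = \<bar>int (P.cyc_num 1 v) - int (P.cyc_num 1 (v ^ 2))\<bar>"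
  have norm: "P.jacobi_trace ^ 2 + 27 * B ^ 2 = 4 * int p"
    using P.four_card_eq card_P by (simp add: B_def)
  have cong: "[P.jacobi_trace = - int ((2 * ((p - 1) div 3)) choose ((p - 1) div 3))] (mod p)"
    using P.jacobi_trace_cong assms(3) by simp
  have not_dvd: "\<not> int p dvd P.jacobi_trace"
    using P.prime_not_dvd_jacobi_trace[OF assms(1,2), of 1] card_P by simp
  have kappa: "kappa p = P.jacobi_trace"
    by (rule kappa_eqI[OF assms(1,2) P.jacobi_trace_mod_3 not_dvd norm cong])
  have "real_of_int (P.jacobi_trace ^ 2 + 27 * B ^ 2) = real_of_int (4 * int p)"
    by (simp only: norm)
  hence "real p - (real_of_int P.jacobi_trace) ^ 2 / 4 = (3 * sqrt 3 / 2 * real_of_int B) ^ 2"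
    by (simp add: power_mult_distrib power_divide)
  moreover have "B \<ge> 0" by (simp add: B_def)
  ultimately have "pi_p p = norm_form_root P.jacobi_trace B"
    by (simp add: pi_p_def norm_form_root_def kappa)
  thus ?thesis using that norm P.jacobi_trace_mod_3 not_dvd by blast
qed

context cubic_subfield
begin

lemma pi_p_power_sum_split:
  assumes "prime p" "p mod 3 = 1" "card K = p ^ k"
  shows "pi_p p ^ k + cnj (pi_p p) ^ k = - of_int jacobi_trace"
proof -
  have char: "CHAR('a) = p" by (rule CHAR_eq_if_card_eq_prime_power[OF assms(1,3)])
  have "k > 0" using assms(3) card_ge_2 by (cases k) auto
  obtain A B where AB: "pi_p p = norm_form_root A B" "A ^ 2 + 27 * B ^ 2 = 4 * int p"
      "A mod 3 = 1" "\<not> int p dvd A"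
    using pi_p_eq_norm_form_root[OF assms(1,2) char] .
  then obtain C D where CD: "pi_p p ^ k = norm_form_root C D" "C mod 3 = 1" "\<not> int p dvd C"
    using norm_form_root_power[OF assms(1,2) AB(3,4,2), of k] \<open>k > 0\<close> by auto
  have "C ^ 2 + 27 * D ^ 2 = 4 * int p ^ k"
    by (rule norm_form_root_power_norm[OF _ AB(2), of k]) (simp only: CD(1) flip: AB(1))
  moreover have "\<not> int p dvd jacobi_trace"
    by (rule prime_not_dvd_jacobi_trace[OF assms])
  moreover have "prime (int p)" "int p \<noteq> 2" using assms(1,2) by auto
  moreover have
    "jacobi_trace ^ 2 + 27 * (int (cyc_num 1 w) - int (cyc_num 1 (w ^ 2))) ^ 2 = 4 * int p ^ k"
    using four_card_eq assms(3) by simp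
  ultimately have "C = jacobi_trace"
    using CD(2,3) jacobi_trace_mod_3 norm_form_27_unique by blast
  thus ?thesis using norm_form_root_add_cnj[of C D] by (simp add: CD(1) flip: complex_cnj_power)
qed

lemma pi_p_power_sum_inert:
  assumes "prime p" "p mod 3 = 2" "card K = p ^ k"
  shows "pi_p p ^ k + cnj (pi_p p) ^ k = - of_int jacobi_trace"
proof -
  have "p ^ k mod 3 = 1" unfolding assms(3)[symmetric] card_K by simp
  have "even k"
  proof (rule ccontr)
    assume "odd k"
    then obtain j where "k = 2 * j + 1" by (rule oddE)
    hence "p ^ k = (p ^ 2) ^ j * p" by (simp add: power_mult)
    moreover have "p ^ 2 mod 3 = 1" using power_mod[of p 3 2] assms(2) by simp
    hence "(p ^ 2) ^ j mod 3 = 1" using power_mod[of "p ^ 2" 3 j] by simp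
    ultimately have "p ^ k mod 3 = 2" using assms(2) mod_mult_eq[of "(p ^ 2) ^ j" 3 p] by simp
    thus False using \<open>p ^ k mod 3 = 1\<close> by simp
  qed
  then obtain j where k: "k = 2 * j" by (rule evenE)
  have trace: "jacobi_trace = - 2 * (- int p) ^ j"
    using inert_prime_power_norm_form[OF assms(1,2) jacobi_trace_mod_3] four_card_eq
    by (simp add: assms(3) k)
  have "kappa p = 0" using assms(2) by (auto simp: kappa_def)
  hence "pi_p p = \<i> * of_real (sqrt (real p))"
    by (simp add: pi_p_def complex_eq_iff)
  hence "pi_p p ^ 2 = - of_nat p" "cnj (pi_p p) ^ 2 = - of_nat p"
    by (simp_all add: power_mult_distrib flip: of_real_power)
  thus ?thesis by (simp add: trace k power_mult)
qed

theorem pi_p_power_sum: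
  assumes "prime p" "card K = p ^ k"
  shows "pi_p p ^ k + cnj (pi_p p) ^ k = - of_int jacobi_trace"
proof -
  have "k > 0" using assms(2) card_ge_2 by (cases k) auto
  have "\<not> 3 dvd p"
  proof
    assume "3 dvd p"
    hence "3 dvd card K" unfolding assms(2) using \<open>k > 0\<close> by (metis dvd_power dvd_trans)
    thus False unfolding card_K by presburger
  qed
  hence "p mod 3 = 1 \<or> p mod 3 = 2" by presburger
  thus ?thesis using pi_p_power_sum_split pi_p_power_sum_inert assms by blast
qed

end

lemma cong_9_iff_cong_3:
  "[int (3 * s + 1) - 3 * int n = 1] (mod 9) \<longleftrightarrow> [n = s] (mod 3)"
proof -
  have "[int (3 * s + 1) - 3 * int n = 1] (mod 9) \<longleftrightarrow> 3 * 3 dvd 3 * (int s - int n)"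
    by (simp add: cong_iff_dvd_diff algebra_simps)
  also have "\<dots> \<longleftrightarrow> [int s = int n] (mod int 3)"
    by (simp only: dvd_times_left_cancel_iff cong_iff_dvd_diff) simp
  also have "\<dots> \<longleftrightarrow> [n = s] (mod 3)" by (simp only: cong_int_iff cong_sym_eq)
  finally show ?thesis .
qed

theorem theorem4p5:
  fixes p k n q :: nat
    and e1 e2 :: int
  assumes "prime p" and "k > 0" and "q = p ^ k"
    and "card (UNIV :: 'a::{finite,field} set) = q"
    and "q mod 3 = 1"
    and "n > 0" and "gcd n ((q - 1) div 3) = 1"
    and "e1 = (if [int q - 3 * int n = 1] (mod 9) then -2 else 1)"
    and "e2 = (if n mod 3 = 0 then -2 else 1)"
  shows "complex_of_nat (card {a::'a. bij (\<lambda>x::'a. x ^ n * (x ^ ((q - 1) div 3) + a))})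
       = (2 * of_nat q - 3 * of_int (e1 + e2) - 10
          - 2 * (pi_p p ^ k + cnj (pi_p p) ^ k)) / 9"
proof -
  interpret U: finite_subfield "UNIV :: 'a set" by (rule finite_subfield_UNIV)
  let ?s = "(q - 1) div 3"
  let ?N = "card {a::'a. bij (\<lambda>x::'a. x ^ n * (x ^ ?s + a))}"
  obtain w :: 'a where "cubic_subfield UNIV w ?s"
    using U.ex_cubic_subfield assms(4,5) by auto
  then interpret F: cubic_subfield "UNIV :: 'a set" w ?s .
  have "q = 3 * ?s + 1" using F.card_K assms(4) by simp
  hence "[int q - 3 * int n = 1] (mod 9) \<longleftrightarrow> [n = ?s] (mod 3)"
    using cong_9_iff_cong_3[of ?s n] by (simp only:)
  moreover have "coprime n ?s" using assms(7) by (simp only: coprime_iff_gcd_eq_1)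
  ultimately have "9 * int ?N = 2 * int q - 3 * (e1 + e2) - 10 + 2 * F.jacobi_trace"
    using F.card_permutation_binomials[OF assms(6)] assms(4,8,9) by (simp add: dvd_eq_mod_eq_0)
  hence "of_int (9 * int ?N) = (of_int (2 * int q - 3 * (e1 + e2) - 10 + 2 * F.jacobi_trace) :: complex)"
    by (simp only:)
  moreover have "pi_p p ^ k + cnj (pi_p p) ^ k = - of_int F.jacobi_trace"
    using F.pi_p_power_sum assms(1,3,4) by simp
  ultimately show ?thesis by (simp add: field_simps)
qed

end
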